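(* Let $n\ge2$ and let $f\in\operatorname{Aut}(\mathcal D_n)$. Then there exists a unitary $u\in\mathcal S_n$ such that $f=\operatorname{Ad}(u)|_{\mathcal D_n}$ if and only if: (i) $f$ eventually preserves standard projections, and (ii) there exist projections $P_i,Q_i$, $i=1,\dots,r$, in $\mathcal D_n$ and non-negative integers $k_i,m_i$, $i=1,\dots,r$, such that $\sum_{i=1}^rP_i=1=\sum_{i=1}^rQ_i$ and $$f\circ M_{P_i}\circ\varphi^{k_i}=M_{Q_i}\circ\varphi^{m_i},\qquad i=1,\dots,r,$$ as maps on $\mathcal D_n$.
   Context: $\mathcal O_n$ is the Cuntz algebra, the $C^*$-algebra generated by isometries $S_1,\dots,S_n$ with $\sum_{i=1}^n S_iS_i^*=1$. For a word $\mu=(\mu_1,\dots,\mu_k)$ in the letters $1,\dots,n$, $|\mu|=k$ is its length, $S_\mu=S_{\mu_1}\cdots S_{\mu_k}$ ($=1$ for the empty word) and $P_\mu=S_\mu S_\mu^*$; $W_n$ is the set of all words. $\mathcal D_n$ is the $C^*$-subalgebra of $\mathcal O_n$ generated by all $P_\mu$. A projection of the form $P_\alpha$, $\alpha\in W_n$, is called standard. A map $f:\mathcal D_n\to\mathcal D_n$ eventually preserves standard projections if there is an integer $m\in\mathbb N$ such that for every $\alpha\in W_n$ with $|\alpha|\ge m$ the image $f(P_\alpha)$ is a standard projection. For $d\in\mathcal D_n$, $M_d:\mathcal D_n\to\mathcal D_n$ is $M_d(x)=dx$. $\varphi(x)=\sum_{i=1}^nS_ixS_i^*$ is the canonical shift,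 which maps $\mathcal D_n$ into itself; $\varphi^0=\mathrm{id}$. $\mathcal S_n$ is the group of unitaries in $\mathcal O_n$ that are finite sums of elements of the form $S_\alpha S_\beta^*$, $\alpha,\beta\in W_n$. $\operatorname{Ad}(u)(x)=uxu^*$; for $u\in\mathcal S_n$ it preserves $\mathcal D_n$. *)

theory Defs
  imports "HOL-Analysis.Analysis"
begin

text \<open>Unital (nonzero) complex \<open>C\<^sup>*\<close>-algebras. The distribution has only real Banach algebras,
  so the complex scalar multiplication and the involution are added here.\<close>

class unital_cstar_algebra = real_normed_algebra_1 + banach +
  fixes scaleC :: "complex \<Rightarrow> 'a \<Rightarrow> 'a" (infixr \<open>*\<^sub>C\<close> 75)
    and star :: "'a \<Rightarrow> 'a"
  assumes scaleC_of_real: "of_real r *\<^sub>C x = r *\<^sub>R x"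
    and scaleC_add_right: "c *\<^sub>C (x + y) = c *\<^sub>C x + c *\<^sub>C y"
    and scaleC_add_left: "(c + d) *\<^sub>C x = c *\<^sub>C x + d *\<^sub>C x"
    and scaleC_scaleC: "c *\<^sub>C d *\<^sub>C x = (c * d) *\<^sub>C x"
    and mult_scaleC_left: "(c *\<^sub>C x) * y = c *\<^sub>C (x * y)"
    and mult_scaleC_right: "x * (c *\<^sub>C y) = c *\<^sub>C (x * y)"
    and norm_scaleC: "norm (c *\<^sub>C x) = cmod c * norm x"
    and star_star: "star (star x) = x"
    and star_add: "star (x + y) = star x + star y"
    and star_scaleC: "star (c *\<^sub>C x) = cnj c *\<^sub>C star x"
    and star_mult: "star (x * y) = star y * star x"
    and norm_star_mult_self: "norm (star x * x) = (norm x)\<^sup>2"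

definition cstar_subalgebra :: "'a::unital_cstar_algebra set \<Rightarrow> bool" where
  "cstar_subalgebra B \<longleftrightarrow> closed B \<and> 0 \<in> B \<and>
     (\<forall>x\<in>B. \<forall>y\<in>B. x + y \<in> B \<and> x * y \<in> B) \<and>
     (\<forall>x\<in>B. star x \<in> B \<and> (\<forall>c. c *\<^sub>C x \<in> B))"

definition projection :: "'a::unital_cstar_algebra \<Rightarrow> bool" where
  "projection p \<longleftrightarrow> p * p = p \<and> star p = p"

definition unitary :: "'a::unital_cstar_algebra \<Rightarrow> bool" where
  "unitary u \<longleftrightarrow> star u * u = 1 \<and> u * star u = 1"

text \<open>Maps defined on a subalgebra \<open>B\<close> are represented by total functions
  whose values outside \<open>B\<close> are irrelevant.\<close>

definition cstar_automorphism_on ::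
    "'a::unital_cstar_algebra set \<Rightarrow> ('a \<Rightarrow> 'a) \<Rightarrow> bool" where
  "cstar_automorphism_on B f \<longleftrightarrow> bij_betw f B B \<and>
     (\<forall>x\<in>B. \<forall>y\<in>B. f (x + y) = f x + f y \<and> f (x * y) = f x * f y) \<and>
     (\<forall>x\<in>B. f (star x) = star (f x) \<and> (\<forall>c. f (c *\<^sub>C x) = c *\<^sub>C f x))"

text \<open>The generating isometries are \<open>S 1, \<dots>, S n\<close>; other values of \<open>S\<close> are irrelevant.
  They may live in any unital \<open>C\<^sup>*\<close>-algebra, and the Cuntz algebra is the
  \<open>C\<^sup>*\<close>-subalgebra that they generate (it contains \<open>1 = star (S 1) * S 1\<close> when \<open>n \<ge> 1\<close>).\<close>

definition cuntz_isometries :: "nat \<Rightarrow> (nat \<Rightarrow> 'a::unital_cstar_algebra) \<Rightarrow> bool" where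
  "cuntz_isometries n S \<longleftrightarrow>
     (\<forall>i\<in>{1..n}. star (S i) * S i = 1) \<and> (\<Sum>i=1..n. S i * star (S i)) = 1"

definition cuntz_algebra :: "nat \<Rightarrow> (nat \<Rightarrow> 'a::unital_cstar_algebra) \<Rightarrow> 'a set" where
  "cuntz_algebra n S = cstar_subalgebra hull (S ` {1..n})"

definition cuntz_words :: "nat \<Rightarrow> nat list set" where
  "cuntz_words n = lists {1..n}"

definition S_word :: "(nat \<Rightarrow> 'a::unital_cstar_algebra) \<Rightarrow> nat list \<Rightarrow> 'a" where
  "S_word S \<mu> = prod_list (map S \<mu>)"

definition P_word :: "(nat \<Rightarrow> 'a::unital_cstar_algebra) \<Rightarrow> nat list \<Rightarrow> 'a" where
  "P_word S \<mu> = S_word S \<mu> * star (S_word S \<mu>)"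

definition cuntz_diagonal :: "nat \<Rightarrow> (nat \<Rightarrow> 'a::unital_cstar_algebra) \<Rightarrow> 'a set" where
  "cuntz_diagonal n S = cstar_subalgebra hull (P_word S ` cuntz_words n)"

definition standard_projections :: "nat \<Rightarrow> (nat \<Rightarrow> 'a::unital_cstar_algebra) \<Rightarrow> 'a set" where
  "standard_projections n S = P_word S ` cuntz_words n"

definition eventually_preserves_standard_projections ::
    "nat \<Rightarrow> (nat \<Rightarrow> 'a::unital_cstar_algebra) \<Rightarrow> ('a \<Rightarrow> 'a) \<Rightarrow> bool" where
  "eventually_preserves_standard_projections n S f \<longleftrightarrow>
     (\<exists>m::nat. \<forall>\<alpha>\<in>cuntz_words n. length \<alpha> \<ge> m \<longrightarrow> f (P_word S \<alpha>) \<in> standard_projections n S)"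

definition left_mult :: "'a::unital_cstar_algebra \<Rightarrow> 'a \<Rightarrow> 'a" where
  "left_mult d x = d * x"

definition canonical_shift :: "nat \<Rightarrow> (nat \<Rightarrow> 'a::unital_cstar_algebra) \<Rightarrow> 'a \<Rightarrow> 'a" where
  "canonical_shift n S x = (\<Sum>i=1..n. S i * x * star (S i))"

text \<open>The finite sums are indexed by lists of pairs of words, so the same term
  \<open>S\<^sub>\<alpha> S\<^sub>\<beta>\<^sup>*\<close> is allowed to occur several times.\<close>

definition cuntz_unitary_group :: "nat \<Rightarrow> (nat \<Rightarrow> 'a::unital_cstar_algebra) \<Rightarrow> 'a set" where
  "cuntz_unitary_group n S =
     {u \<in> cuntz_algebra n S. unitary u \<and>
        (\<exists>ps \<in> lists (cuntz_words n \<times> cuntz_words n).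
           u = (\<Sum>(\<alpha>, \<beta>)\<leftarrow>ps. S_word S \<alpha> * star (S_word S \<beta>)))}"

definition Ad :: "'a::unital_cstar_algebra \<Rightarrow> 'a \<Rightarrow> 'a" where
  "Ad u x = u * x * star u"

end

theory Submission
  imports Defs "HOL-Library.Sublist"
begin

text \<open>If \<open>u \<in> \<S>\<^sub>n\<close>, then for the words \<open>\<beta>\<close> of a fixed large length \<open>u S\<^sub>\<beta>\<close> is an isometry which is a
  sum of elements \<open>S\<^sub>\<alpha>\<close>, and counting shows that there is only one summand; conditions (i) and (ii)
  follow with the partition \<open>{P\<^sub>\<beta>}\<close>. Conversely, a projection of \<open>\<D>\<^sub>n\<close> is \<open>0\<close> or \<open>1\<close> below every
  \<open>P\<^sub>\<mu>\<close> with \<open>\<mu>\<close> long, so (ii) can be cut down to \<open>f (P\<^sub>\<mu> \<phi>\<^sup>k(x)) = P\<^sub>\<sigma> \<phi>\<^sup>m(x)\<close> with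
  \<open>P\<^sub>\<sigma> = f(P\<^sub>\<mu>)\<close>. Testing this on standard projections forces \<open>\<sigma>\<close> to end with the last
  \<open>|\<mu>| - k\<close> letters of \<open>\<mu>\<close> and to have length \<open>m + |\<mu>| - k\<close>, whence
  \<open>f (S\<^sub>\<mu> y S\<^sub>\<mu>\<^sup>*) = S\<^sub>\<sigma> y S\<^sub>\<sigma>\<^sup>*\<close> for all \<open>y \<in> \<D>\<^sub>n\<close>, and \<open>u = \<Sum> S\<^sub>\<sigma> S\<^sub>\<mu>\<^sup>*\<close> implements \<open>f\<close>.
  Since (ii) holds on all of \<open>\<D>\<^sub>n\<close>, continuity of \<open>f\<close> is never needed.\<close>

section \<open>Unital C*-algebras\<close>

lemma star_zero [simp]: "star (0::'a::unital_cstar_algebra) = 0"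
  using star_add[of 0 "0::'a"] by simp

lemma star_uminus: "star (- x) = - star (x::'a::unital_cstar_algebra)"
  using star_add[of x "- x"] by (simp add: eq_neg_iff_add_eq_0 add.commute)

lemma star_diff: "star (x - y) = star x - star (y::'a::unital_cstar_algebra)"
  using star_add[of x "- y"] by (simp add: star_uminus)

lemma star_one [simp]: "star (1::'a::unital_cstar_algebra) = 1"
  using star_mult[of "star 1" "1::'a"] by (simp add: star_star)

lemma star_sum: "star (sum g A) = (\<Sum>i\<in>A. star (g i :: 'a::unital_cstar_algebra))"
  by (induction A rule: infinite_finite_induct) (simp_all add: star_add)

lemma star_scaleR: "star (r *\<^sub>R x) = r *\<^sub>R star (x::'a::unital_cstar_algebra)"
  using star_scaleC[of "of_real r" x] by (simp add: scaleC_of_real)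

text \<open>The C*-identity and submultiplicativity give \<open>norm y \<le> norm (star y)\<close>;
  applying this to \<open>star y\<close> as well gives equality.\<close>

lemma norm_star: "norm (star x) = norm (x::'a::unital_cstar_algebra)"
proof -
  have le: "norm y \<le> norm (star y)" for y :: 'a
  proof (cases "y = 0")
    case False
    have "norm y * norm y \<le> norm (star y) * norm y"
      using norm_mult_ineq[of "star y" y] by (simp add: norm_star_mult_self power2_eq_square)
    with False show ?thesis by simp
  qed simp
  show ?thesis using le[of x] le[of "star x"] by (simp add: star_star)
qed

lemma bounded_linear_star: "bounded_linear (star :: 'a \<Rightarrow> 'a::unital_cstar_algebra)"
  by (rule bounded_linear_intro[where K = 1]) (simp_all add: star_add star_scaleR norm_star)

lemmas continuous_on_star [continuous_intros] = bounded_linear.continuous_on[OF bounded_linear_star]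

lemma scaleC_scaleR: "c *\<^sub>C r *\<^sub>R x = r *\<^sub>R c *\<^sub>C (x::'a::unital_cstar_algebra)"
  by (metis mult.commute scaleC_of_real scaleC_scaleC)

lemma bounded_linear_scaleC: "bounded_linear (\<lambda>x :: 'a::unital_cstar_algebra. c *\<^sub>C x)"
  by (rule bounded_linear_intro[where K = "cmod c"])
    (simp_all add: scaleC_add_right scaleC_scaleR norm_scaleC mult.commute)

lemmas continuous_on_scaleC [continuous_intros] =
  bounded_linear.continuous_on[OF bounded_linear_scaleC]

lemma scaleC_one [simp]: "1 *\<^sub>C x = (x::'a::unital_cstar_algebra)"
  using scaleC_of_real[of 1 x] by simp

lemma scaleC_minus_left: "(- c) *\<^sub>C x = - (c *\<^sub>C (x::'a::unital_cstar_algebra))"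
  using scaleC_scaleC[of "-1" c x] scaleC_of_real[of "-1" "c *\<^sub>C x"] by simp

lemma scaleC_zero_left [simp]: "0 *\<^sub>C x = (0::'a::unital_cstar_algebra)"
  using scaleC_of_real[of 0 x] by simp

lemma scaleC_diff_left: "(c - d) *\<^sub>C x = c *\<^sub>C x - d *\<^sub>C (x::'a::unital_cstar_algebra)"
  by (metis add_diff_cancel_right' diff_add_cancel scaleC_add_left)

lemma scaleC_diff_right: "c *\<^sub>C (x - y) = c *\<^sub>C x - c *\<^sub>C (y::'a::unital_cstar_algebra)"
  by (metis add_diff_cancel_right' diff_add_cancel scaleC_add_right)

section \<open>Norm estimates for projections, and orthogonality of projections with sum 1\<close>

lemma star_mult_self_eq_0_iff: "star x * x = 0 \<longleftrightarrow> (x::'a::unital_cstar_algebra) = 0"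
  using norm_star_mult_self[of x] by auto

lemma norm_projection_le: "projection (p::'a::unital_cstar_algebra) \<Longrightarrow> norm p \<le> 1"
  using norm_star_mult_self[of p] by (cases "p = 0") (auto simp: projection_def power2_eq_square)

lemma norm_projection:
  "projection (p::'a::unital_cstar_algebra) \<Longrightarrow> p \<noteq> 0 \<Longrightarrow> norm p = 1"
  using norm_star_mult_self[of p] by (auto simp: projection_def power2_eq_square)

text \<open>The elements x + iy and x - iy are normal, and by the C*-identity both have squared norm
  \<open>norm (x * x + y * y)\<close>. As x is their average, the bound follows without any order on
  self-adjoint elements.\<close>

lemma norm_le_sum_of_squares:
  fixes x y :: "'a::unital_cstar_algebra"
  assumes x: "star x = x" and y: "star y = y" and comm: "x * y = y * x"
  shows "(norm x)\<^sup>2 \<le> norm (x * x + y * y)"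
proof -
  have eq: "(norm (x + c *\<^sub>C y))\<^sup>2 = norm (x * x + y * y)" if "c = \<i> \<or> c = - \<i>" for c
  proof -
    have c: "cnj c = - c" "- c * c = 1" using that by auto
    have "star (x + c *\<^sub>C y) * (x + c *\<^sub>C y)
        = x * x + (- c * c) *\<^sub>C (y * y) + (c *\<^sub>C (x * y) + (- c) *\<^sub>C (x * y))"
      by (simp add: star_add star_scaleC x y c(1) distrib_left distrib_right mult_scaleC_left
          mult_scaleC_right scaleC_scaleC scaleC_add_right comm add_ac)
    also have "\<dots> = x * x + y * y"
      unfolding c(2) using scaleC_diff_left[of c c "x * y"] scaleC_add_left[of c "- c" "x * y"] by simp
    finally show ?thesis by (simp add: norm_star_mult_self[symmetric])
  qed
  have "2 *\<^sub>R x = (x + \<i> *\<^sub>C y) + (x + (- \<i>) *\<^sub>C y)"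
    using scaleC_diff_left[of "\<i>" "\<i>" y] scaleC_add_left[of "\<i>" "- \<i>" y]
    by (simp add: scaleR_2)
  hence "2 * norm x \<le> norm (x + \<i> *\<^sub>C y) + norm (x + (- \<i>) *\<^sub>C y)"
    by (metis norm_scaleR norm_triangle_ineq abs_numeral)
  also have "norm (x + (- \<i>) *\<^sub>C y) = norm (x + \<i> *\<^sub>C y)"
    using eq[of "\<i>"] eq[of "- \<i>"] by (metis norm_ge_zero power2_eq_imp_eq)
  finally have "norm x \<le> norm (x + \<i> *\<^sub>C y)" by simp
  thus ?thesis using eq[of "\<i>"] by (metis norm_ge_zero power_mono)
qed

text \<open>The contraction \<open>c = e + h\<^sup>2\<close> satisfies \<open>e - c \<ge> 0\<close>. To avoid spectral theory, a square root
  \<open>z = e - w\<close> of \<open>e - (1 - s\<^sup>2) c\<close> is obtained from the fixed point equation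
  \<open>2 w = (1 - s\<^sup>2) c + w\<^sup>2\<close>, a contraction on the ball of radius \<open>1 - s\<close>; then
  \<open>(1 - s\<^sup>2) h\<^sup>2 + z\<^sup>2 = s\<^sup>2 e\<close>.\<close>

lemma norm_perturbation_le:
  fixes e h :: "'a::unital_cstar_algebra"
  assumes e: "projection e" and h: "star h = h" "e * h = h" "h * e = h"
    and plus: "norm (e + h) \<le> 1" and minus: "norm (e - h) \<le> 1"
    and s: "0 < s" "s < 1"
  shows "(1 - s\<^sup>2) * (norm h)\<^sup>2 \<le> s\<^sup>2"
proof -
  note ee = e[unfolded projection_def]
  define c where "c = e + h * h"
  have c_props: "star c = c" "e * c = c" "c * e = c" "c * h = h * c"
    using ee h by (simp_all add: c_def star_add star_mult algebra_simps flip: mult.assoc)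
      (simp_all add: mult.assoc)
  \<comment> \<open>A parallelogram identity makes c an average of the squares of two
    contractions.\<close>
  have "2 *\<^sub>R c = (e + h) * (e + h) + (e - h) * (e - h)"
    using ee h by (simp add: c_def algebra_simps scaleR_2)
  hence "2 * norm c \<le> norm ((e + h) * (e + h)) + norm ((e - h) * (e - h))"
    by (metis norm_scaleR norm_triangle_ineq abs_numeral)
  also have "\<dots> \<le> 1 * 1 + 1 * 1"
    by (intro add_mono order_trans[OF norm_mult_ineq] mult_mono plus minus) auto
  finally have c_le: "norm c \<le> 1" by simp
  define d where "d = 1 - s\<^sup>2"
  have "s\<^sup>2 < 1" using s by (simp add: abs_square_less_1)
  hence d: "0 < d" by (simp add: d_def)
  define T where "T w = (1/2) *\<^sub>R (d *\<^sub>R c + w * w)" for w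
  \<comment> \<open>Besides the radius, X records what the iteration preserves. Self-adjointness and
    commutation with h pass from w to z, as \<open>norm_le_sum_of_squares\<close> requires; the
    conditions on e give the formula for \<open>z * z\<close>.\<close>
  define X where "X = {w. norm w \<le> 1 - s \<and> star w = w \<and> e * w = w \<and> w * e = w \<and> w * h = h * w}"
  have "\<exists>!w. w \<in> X \<and> T w = w"
  proof (rule Banach_fix)
    have "closed X"
      unfolding X_def by (intro closed_Collect_conj closed_Collect_le closed_Collect_eq continuous_intros)
    thus "complete X" by (simp add: complete_eq_closed)
    have "0 \<in> X" using s by (simp add: X_def)
    thus "X \<noteq> {}" by blast
    show "0 \<le> 1 - s" "1 - s < 1" using s by auto
    show "T ` X \<subseteq> X"
    proof safe
      fix w assume w: "w \<in> X"
      have "norm (w * w) \<le> (1 - s) * (1 - s)"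
        using w s by (intro order_trans[OF norm_mult_ineq] mult_mono) (auto simp: X_def)
      moreover have "norm (d *\<^sub>R c) \<le> d" using c_le d by simp
      ultimately have "norm (d *\<^sub>R c + w * w) \<le> d + (1 - s) * (1 - s)"
        by (meson add_mono norm_triangle_ineq order_trans)
      \<comment> \<open>The radius 1 - s solves the scalar equation 2 t = d + t^2, so T maps the
        ball into itself.\<close>
      also have "\<dots> = 2 * (1 - s)" by (simp add: d_def power2_eq_square algebra_simps)
      finally have "norm (T w) \<le> 1 - s" by (simp add: T_def)
      moreover have "w * w * h = h * (w * w)"
        using w by (simp add: X_def) (metis mult.assoc)
      moreover have "e * (w * w) = w * w" "w * w * e = w * w"
        using w by (simp_all add: X_def) (metis mult.assoc)+
      ultimately show "T w \<in> X"
        using w c_props by (simp add: X_def T_def star_scaleR star_add star_mult algebra_simps)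
    qed
    show "dist (T x) (T y) \<le> (1 - s) * dist x y" if "x \<in> X" "y \<in> X" for x y
    proof -
      have "T x - T y = (1/2) *\<^sub>R (x * (x - y) + (x - y) * y)"
        by (simp add: T_def algebra_simps)
      hence "norm (T x - T y) \<le> 1/2 * (norm x * norm (x - y) + norm (x - y) * norm y)"
        using norm_triangle_ineq[of "x * (x - y)" "(x - y) * y"]
          norm_mult_ineq[of x "x - y"] norm_mult_ineq[of "x - y" y] by simp
      also have "\<dots> \<le> 1/2 * ((1 - s) * norm (x - y) + norm (x - y) * (1 - s))"
        using that by (intro mult_left_mono add_mono mult_right_mono) (auto simp: X_def)
      finally show ?thesis by (simp add: dist_norm algebra_simps)
    qed
  qed
  then obtain w where w: "w \<in> X" "T w = w" by blast
  hence "w + w = d *\<^sub>R c + w * w" by (metis T_def scaleR_half_double scaleR_add_right)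
  define z where "z = e - w"
  have "z * z = s\<^sup>2 *\<^sub>R e - d *\<^sub>R (h * h)"
  proof -
    have "z * z = e - (w + w) + w * w"
      using w ee by (simp add: z_def X_def algebra_simps)
    also have "\<dots> = e - d *\<^sub>R c" using \<open>w + w = _\<close> by simp
    also have "\<dots> = s\<^sup>2 *\<^sub>R e - d *\<^sub>R (h * h)" by (simp add: c_def d_def algebra_simps)
    finally show ?thesis .
  qed
  hence "(sqrt d *\<^sub>R h) * (sqrt d *\<^sub>R h) + z * z = s\<^sup>2 *\<^sub>R e"
    using d by simp
  moreover have "(norm (sqrt d *\<^sub>R h))\<^sup>2 \<le> norm ((sqrt d *\<^sub>R h) * (sqrt d *\<^sub>R h) + z * z)"
    using w h ee by (intro norm_le_sum_of_squares)
      (auto simp: z_def X_def star_scaleR star_diff algebra_simps)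
  ultimately have "d * (norm h)\<^sup>2 \<le> norm (s\<^sup>2 *\<^sub>R e)"
    using d by (simp add: power_mult_distrib)
  also have "\<dots> \<le> s\<^sup>2" using norm_projection_le[OF e] by (simp add: mult_left_le)
  finally show ?thesis by (simp add: d_def)
qed

text \<open>The bound \<open>norm_perturbation_le\<close> holds for every s strictly between 0 and
  1; letting s tend to 0 leaves \<open>(norm h)\<^sup>2 \<le> 0\<close>. In self-adjoint directions,
  a projection is thus an extreme point of the unit ball of its corner.\<close>

lemma projection_extreme:
  fixes e h :: "'a::unital_cstar_algebra"
  assumes "projection e" "star h = h" "e * h = h" "h * e = h" "norm (e + h) \<le> 1" "norm (e - h) \<le> 1"
  shows "h = 0"
proof -
  have "((\<lambda>s. (1 - s\<^sup>2) * (norm h)\<^sup>2) \<longlongrightarrow> (1 - 0\<^sup>2) * (norm h)\<^sup>2) (at_right (0::real))"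
    by (intro tendsto_intros)
  moreover have "((\<lambda>s::real. s\<^sup>2) \<longlongrightarrow> 0\<^sup>2) (at_right (0::real))"
    by (intro tendsto_intros)
  moreover have "\<forall>\<^sub>F s in at_right (0::real). (1 - s\<^sup>2) * (norm h)\<^sup>2 \<le> s\<^sup>2"
    using eventually_at_right_less[of 0] eventually_at_right_real[of 0 1]
    by (rule eventually_elim2) (use norm_perturbation_le[OF assms] in auto)
  ultimately have "(1 - 0\<^sup>2) * (norm h)\<^sup>2 \<le> 0\<^sup>2"
    by (intro tendsto_le[OF trivial_limit_at_right_real])
  thus ?thesis by simp
qed

text \<open>In the corner of \<open>e = p j\<close> the elements \<open>e p\<^sub>k e\<close> with \<open>k \<noteq> j\<close> sum to zero while each \<open>e - 2 e p\<^sub>k e\<close>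
  is a contraction, so extremality of \<open>e\<close> in the unit ball applies.\<close>

lemma projections_sum_one_orthogonal:
  fixes p :: "'i \<Rightarrow> 'a::unital_cstar_algebra"
  assumes fin: "finite A" and proj: "\<And>i. i \<in> A \<Longrightarrow> projection (p i)" and one: "sum p A = 1"
    and ij: "i \<in> A" "j \<in> A" "i \<noteq> j"
  shows "p i * p j = 0"
proof -
  define e where "e = p j"
  have e: "projection e" and ee: "e * e = e" "star e = e"
    using proj[OF ij(2)] by (auto simp: e_def projection_def)
  define a where "a k = e * p k * e" for k
  have contr: "norm (e - 2 *\<^sub>R a k) \<le> 1" if "k \<in> A" for k
  proof -
    \<comment> \<open>\<open>1 - 2 *\<^sub>R p k\<close> is a self-adjoint unitary, and its
      compression by e is \<open>e - 2 *\<^sub>R a k\<close>.\<close>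
    have "star (1 - 2 *\<^sub>R p k) * (1 - 2 *\<^sub>R p k) = 1"
      using proj[OF that] by (simp add: projection_def star_diff star_scaleR star_add algebra_simps scaleR_2)
    hence "(norm (1 - 2 *\<^sub>R p k))\<^sup>2 = 1" by (metis norm_star_mult_self norm_one)
    hence u: "norm (1 - 2 *\<^sub>R p k) \<le> 1" unfolding power2_eq_1_iff by linarith
    have "e - 2 *\<^sub>R a k = e * (1 - 2 *\<^sub>R p k) * e"
      by (simp add: a_def algebra_simps ee)
    hence "norm (e - 2 *\<^sub>R a k) \<le> norm (e * (1 - 2 *\<^sub>R p k)) * norm e"
      using norm_mult_ineq by metis
    also have "\<dots> \<le> (1 * 1) * 1"
      by (intro mult_mono order_trans[OF norm_mult_ineq] u norm_projection_le[OF e]) auto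
    finally show ?thesis by simp
  qed
  have "sum a A = e * sum p A * e" by (simp add: a_def sum_distrib_left sum_distrib_right)
  hence "sum a A = e" by (simp add: one ee)
  moreover have "a j = e" unfolding a_def e_def[symmetric] by (simp add: ee)
  moreover define B where "B = A - {j} - {i}"
  moreover have "sum a A = a j + (a i + sum a B)"
    unfolding B_def using fin ij by (simp add: sum.remove[of A j] sum.remove[of "A - {j}" i])
  ultimately have rest: "sum a B = - a i" by (simp add: eq_neg_iff_add_eq_0 add.commute)
  define N where "N = card B"
  \<comment> \<open>Summing the contractions over B replaces the unknown \<open>a k\<close> by
    \<open>a i\<close> alone, with the opposite sign.\<close>
  have "norm (\<Sum>k\<in>B. e - 2 *\<^sub>R a k) \<le> of_nat N * 1"
    unfolding N_def by (rule sum_norm_bound) (use contr in \<open>auto simp: B_def\<close>)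
  moreover have "(\<Sum>k\<in>B. e - 2 *\<^sub>R a k) = N *\<^sub>R e + 2 *\<^sub>R a i"
    unfolding sum_subtractf scaleR_sum_right[symmetric] rest N_def by (simp add: sum_constant_scaleR del: sum_constant)
  ultimately have N: "norm (N *\<^sub>R e + 2 *\<^sub>R a i) \<le> N" by simp
  \<comment> \<open>Both e + h and e - h are averages of N + 1 contractions: the N contractions
    indexed by B together with e for the plus sign, and N copies of e together with
    \<open>e - 2 *\<^sub>R a i\<close> for the minus sign.\<close>
  define c where "c = 1 / (real N + 1)"
  have c: "c * N + c = 1" "0 < c" "c * (real N + 1) = 1" by (simp_all add: c_def field_simps)
  define h where "h = (2 * c) *\<^sub>R a i"
  have "h = 0"
  proof (rule projection_extreme[OF e])
    have pi: "star (p i) = p i" using proj[OF ij(1)] by (simp add: projection_def)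
    have "star (a i) = a i" by (simp add: a_def star_mult ee pi mult.assoc)
    moreover have "e * a i = a i" by (simp add: a_def mult.assoc[symmetric] ee)
    moreover have "a i * e = a i" by (simp add: a_def mult.assoc ee)
    ultimately show "star h = h" "e * h = h" "h * e = h" by (simp_all add: h_def star_scaleR)
    have "norm ((N *\<^sub>R e + 2 *\<^sub>R a i) + e) \<le> real N + 1"
      using N norm_projection_le[OF e] norm_triangle_ineq[of "N *\<^sub>R e + 2 *\<^sub>R a i" e] by linarith
    hence "c * norm ((N *\<^sub>R e + 2 *\<^sub>R a i) + e) \<le> 1"
      using c(2,3) by (metis mult_left_mono less_imp_le)
    moreover have "e + h = c *\<^sub>R ((N *\<^sub>R e + 2 *\<^sub>R a i) + e)"
    proof -
      have "c *\<^sub>R ((N *\<^sub>R e + 2 *\<^sub>R a i) + e) = (c * N + c) *\<^sub>R e + h"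
        by (simp add: h_def scaleR_add_left scaleR_add_right mult.commute del: distrib_left_numeral)
      thus ?thesis by (simp add: c)
    qed
    ultimately show "norm (e + h) \<le> 1" using c(2) by simp
    have "norm (N *\<^sub>R e) \<le> N" using norm_projection_le[OF e] by (simp add: mult_left_le)
    hence "norm (N *\<^sub>R e + (e - 2 *\<^sub>R a i)) \<le> real N + 1"
      using contr[OF ij(1)] norm_triangle_ineq[of "N *\<^sub>R e" "e - 2 *\<^sub>R a i"] by linarith
    hence "c * norm (N *\<^sub>R e + (e - 2 *\<^sub>R a i)) \<le> 1"
      using c(2,3) by (metis mult_left_mono less_imp_le)
    moreover have "e - h = c *\<^sub>R (N *\<^sub>R e + (e - 2 *\<^sub>R a i))"
    proof -
      have "c *\<^sub>R (N *\<^sub>R e + (e - 2 *\<^sub>R a i)) = (c * N + c) *\<^sub>R e - h"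
        by (simp add: h_def scaleR_add_left scaleR_add_right scaleR_diff_right mult.commute)
      thus ?thesis by (simp add: c)
    qed
    ultimately show "norm (e - h) \<le> 1" using c(2) by simp
  qed
  hence "a i = 0" using c(2) by (simp add: h_def)
  \<comment> \<open>The C*-identity upgrades \<open>e * p i * e = 0\<close> to
    \<open>p i * e = 0\<close>.\<close>
  moreover have "star (p i * e) * (p i * e) = a i"
  proof -
    have pi: "p i * p i = p i" "star (p i) = p i" using proj[OF ij(1)] by (auto simp: projection_def)
    have "star (p i * e) * (p i * e) = e * (p i * p i) * e"
      by (simp only: star_mult ee(2) pi(2) mult.assoc)
    also have "\<dots> = a i" by (simp only: pi(1) a_def)
    finally show ?thesis .
  qed
  ultimately show ?thesis by (metis e_def star_mult_self_eq_0_iff)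
qed

section \<open>Generated C*-subalgebras\<close>

lemma cstar_subalgebraD:
  assumes "cstar_subalgebra B"
  shows "closed B" "0 \<in> B" "x \<in> B \<Longrightarrow> y \<in> B \<Longrightarrow> x + y \<in> B" "x \<in> B \<Longrightarrow> y \<in> B \<Longrightarrow> x * y \<in> B"
    "x \<in> B \<Longrightarrow> star x \<in> B" "x \<in> B \<Longrightarrow> c *\<^sub>C x \<in> B"
  using assms by (auto simp: cstar_subalgebra_def)

lemma cstar_subalgebra_sum:
  assumes "cstar_subalgebra B" "\<And>i. i \<in> A \<Longrightarrow> g i \<in> B"
  shows "sum g A \<in> B"
  using assms(2) by (induction A rule: infinite_finite_induct) (auto intro: cstar_subalgebraD[OF assms(1)])

lemma cstar_subalgebra_hull: "cstar_subalgebra (cstar_subalgebra hull X)"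
  by (rule hull_in) (auto simp: cstar_subalgebra_def intro!: closed_Inter)

lemma cstar_subalgebra_hull_minimal:
  assumes "cstar_subalgebra B" "X \<subseteq> B" "x \<in> cstar_subalgebra hull X"
  shows "x \<in> B"
  using hull_minimal[of X B cstar_subalgebra] assms by blast

section \<open>Words and the diagonal subalgebra\<close>

lemma S_word_Nil [simp]: "S_word S [] = 1"
  by (simp add: S_word_def)

lemma S_word_Cons: "S_word S (i # \<mu>) = S i * S_word S \<mu>"
  by (simp add: S_word_def)

lemma S_word_append: "S_word S (\<mu> @ \<nu>) = S_word S \<mu> * S_word S \<nu>"
  by (simp add: S_word_def)

lemma P_word_append: "P_word S (\<mu> @ \<nu>) = S_word S \<mu> * P_word S \<nu> * star (S_word S \<mu>)"
  by (simp add: P_word_def S_word_append star_mult mult.assoc)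

lemma star_P_word: "star (P_word S \<mu>) = P_word S \<mu>"
  by (simp add: P_word_def star_mult star_star)

lemma cuntz_words_append [simp]:
  "\<mu> @ \<nu> \<in> cuntz_words n \<longleftrightarrow> \<mu> \<in> cuntz_words n \<and> \<nu> \<in> cuntz_words n"
  by (auto simp: cuntz_words_def)

lemma cuntz_words_Cons [simp]:
  "i # \<mu> \<in> cuntz_words n \<longleftrightarrow> i \<in> {1..n} \<and> \<mu> \<in> cuntz_words n"
  by (auto simp: cuntz_words_def)

lemma cuntz_words_Nil [simp]: "[] \<in> cuntz_words n"
  by (simp add: cuntz_words_def)

lemma cuntz_words_take_drop [intro]:
  assumes "\<mu> \<in> cuntz_words n"
  shows "take k \<mu> \<in> cuntz_words n" "drop k \<mu> \<in> cuntz_words n"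
  using assms unfolding cuntz_words_def by (auto dest: in_set_takeD in_set_dropD)

definition words_of_length :: "nat \<Rightarrow> nat \<Rightarrow> nat list set" where
  "words_of_length n k = {\<mu> \<in> cuntz_words n. length \<mu> = k}"

lemma words_of_length_0 [simp]: "words_of_length n 0 = {[]}"
  by (auto simp: words_of_length_def)

lemma words_of_length_Suc:
  "words_of_length n (Suc k) = (\<lambda>(i, \<mu>). i # \<mu>) ` ({1..n} \<times> words_of_length n k)"
proof -
  have "\<mu> \<in> (\<lambda>(i, \<mu>). i # \<mu>) ` ({1..n} \<times> words_of_length n k)"
    if "\<mu> \<in> words_of_length n (Suc k)" for \<mu>
    using that by (cases \<mu>) (auto simp: words_of_length_def)
  thus ?thesis by (auto simp: words_of_length_def)
qed

lemma finite_words_of_length [simp]: "finite (words_of_length n k)"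
  by (induction k) (auto simp: words_of_length_Suc)

lemma sum_words_of_length_Suc:
  "(\<Sum>\<mu>\<in>words_of_length n (Suc k). g \<mu>) = (\<Sum>i=1..n. \<Sum>\<mu>\<in>words_of_length n k. g (i # \<mu>))"
proof -
  have "inj_on (\<lambda>(i, \<mu>). i # \<mu>) ({1..n} \<times> words_of_length n k)"
    by (auto simp: inj_on_def)
  thus ?thesis
    by (simp add: words_of_length_Suc sum.reindex sum.cartesian_product case_prod_unfold)
qed

lemma canonical_shift_power:
  "(canonical_shift n S ^^ k) x = (\<Sum>\<mu>\<in>words_of_length n k. S_word S \<mu> * x * star (S_word S \<mu>))"
proof (induction k)
  case (Suc k)
  thus ?case
    by (simp add: sum_words_of_length_Suc canonical_shift_def sum_distrib_left sum_distrib_right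
        S_word_Cons star_mult mult.assoc)
qed simp

section \<open>Cuntz relations for words\<close>

locale cuntz_family =
  fixes n :: nat and S :: "nat \<Rightarrow> 'a::unital_cstar_algebra"
  assumes isometries: "cuntz_isometries n S"
begin

abbreviation "W \<equiv> cuntz_words n"
abbreviation "D \<equiv> cuntz_diagonal n S"
abbreviation "V \<equiv> S_word S"
abbreviation "P \<equiv> P_word S"
abbreviation "\<phi> \<equiv> canonical_shift n S"

lemma isometry: "i \<in> {1..n} \<Longrightarrow> star (S i) * S i = 1"
  using isometries by (auto simp: cuntz_isometries_def)

lemma isometry_mult: "i \<in> {1..n} \<Longrightarrow> star (S i) * (S i * x) = x"
  by (simp add: isometry flip: mult.assoc)

text \<open>The definition only says that the range projections \<open>S k * star (S k)\<close> sum
  to 1. Their orthogonality comes from \<open>projections_sum_one_orthogonal\<close>, and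
  multiplying by \<open>star (S i)\<close> and \<open>S j\<close> carries it over to the
  isometries.\<close>

lemma orthogonal_isometries:
  assumes "i \<in> {1..n}" "j \<in> {1..n}" "i \<noteq> j"
  shows "star (S i) * S j = 0"
proof -
  have proj: "projection (S k * star (S k))" if "k \<in> {1..n}" for k
    using that by (simp add: projection_def star_mult star_star mult.assoc isometry_mult)
  have "(S i * star (S i)) * (S j * star (S j)) = 0"
    using projections_sum_one_orthogonal[OF _ proj, of "{1..n}" "\<lambda>k. k" i j] isometries assms
    by (simp add: cuntz_isometries_def)
  hence "star (S i) * ((S i * star (S i)) * (S j * star (S j))) * S j = 0" by simp
  thus ?thesis using assms by (simp add: mult.assoc isometry_mult isometry)
qed

lemma V_isometry: "\<mu> \<in> W \<Longrightarrow> star (V \<mu>) * V \<mu> = 1"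
  by (induction \<mu>) (auto simp: S_word_Cons star_mult mult.assoc isometry_mult)

lemma V_isometry_mult: "\<mu> \<in> W \<Longrightarrow> star (V \<mu>) * (V \<mu> * x) = x"
  by (simp add: V_isometry flip: mult.assoc)

text \<open>The common prefix cancels, and at the first letter where the words differ
  \<open>orthogonal_isometries\<close> gives 0.\<close>

lemma V_parallel:
  assumes "\<mu> \<in> W" "\<nu> \<in> W" "\<mu> \<parallel> \<nu>"
  shows "star (V \<mu>) * V \<nu> = 0"
proof -
  from parallel_decomp[OF assms(3)] obtain as b bs c cs
    where eq: "b \<noteq> c" "\<mu> = as @ b # bs" "\<nu> = as @ c # cs" by blast
  have "star (V \<mu>) * V \<nu> = star (V bs) * (star (S b) * S c) * V cs"
    using eq assms by (simp add: S_word_append S_word_Cons star_mult mult.assoc V_isometry_mult)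
  thus ?thesis using eq assms by (simp add: orthogonal_isometries)
qed

lemma V_same_length:
  assumes "\<mu> \<in> W" "\<nu> \<in> W" "length \<mu> = length \<nu>"
  shows "star (V \<mu>) * V \<nu> = (if \<mu> = \<nu> then 1 else 0)"
proof (cases "\<mu> = \<nu>")
  case False
  hence "\<mu> \<parallel> \<nu>" using assms(3) by (intro parallelI) (auto simp: prefix_def)
  with False show ?thesis using V_parallel assms by simp
qed (use assms V_isometry in auto)

lemma P_mult_V: "\<mu> \<in> W \<Longrightarrow> P \<mu> * V \<mu> = V \<mu>"
  by (simp add: P_word_def mult.assoc V_isometry)

lemma P_mult_V_append: "\<mu> \<in> W \<Longrightarrow> P \<mu> * V (\<mu> @ \<nu>) = V (\<mu> @ \<nu>)"
  by (simp add: S_word_append P_mult_V flip: mult.assoc)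

lemma star_V_mult_P: "\<mu> \<in> W \<Longrightarrow> star (V \<mu>) * P \<mu> = star (V \<mu>)"
  by (simp add: P_word_def V_isometry_mult)

lemma P_idem: "\<mu> \<in> W \<Longrightarrow> P \<mu> * P \<mu> = P \<mu>"
  by (simp add: P_word_def mult.assoc V_isometry_mult)

lemma projection_P: "\<mu> \<in> W \<Longrightarrow> projection (P \<mu>)"
  by (simp add: projection_def P_idem star_P_word)

lemma P_neq_0: "\<mu> \<in> W \<Longrightarrow> P \<mu> \<noteq> 0"
  by (metis P_mult_V V_isometry mult_zero_left mult_zero_right zero_neq_one)

lemma P_parallel: "\<mu> \<in> W \<Longrightarrow> \<nu> \<in> W \<Longrightarrow> \<mu> \<parallel> \<nu> \<Longrightarrow> P \<mu> * P \<nu> = 0"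
  using V_parallel[of \<mu> \<nu>] by (simp add: P_word_def mult.assoc) (simp flip: mult.assoc)

lemma P_append_mult: "\<mu> \<in> W \<Longrightarrow> \<nu> \<in> W \<Longrightarrow> P (\<mu> @ \<nu>) * P \<mu> = P (\<mu> @ \<nu>)"
  by (simp add: P_word_def S_word_append star_mult mult.assoc V_isometry_mult)

lemma P_mult_append: "\<mu> \<in> W \<Longrightarrow> \<nu> \<in> W \<Longrightarrow> P \<mu> * P (\<mu> @ \<nu>) = P (\<mu> @ \<nu>)"
  by (simp add: P_word_def S_word_append star_mult mult.assoc V_isometry_mult)

lemma shift_power_one [simp]: "(\<phi> ^^ k) 1 = 1"
  by (induction k) (use isometries in \<open>auto simp: canonical_shift_def cuntz_isometries_def\<close>)

lemma sum_P: "(\<Sum>\<mu>\<in>words_of_length n k. P \<mu>) = 1"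
  using canonical_shift_power[of k n S 1] by (simp add: P_word_def)

text \<open>In the expansion of the shift over words of length |\<mu>|, every term except that of
  \<mu> begins with a word orthogonal to \<mu>. The tail \<nu> lets the shift be evaluated below a
  smaller projection, whose word has more letters than there are shifts.\<close>

lemma P_mult_shift_power:
  assumes "\<mu> \<in> W" "\<nu> \<in> W"
  shows "P (\<mu> @ \<nu>) * (\<phi> ^^ length \<mu>) x = P (\<mu> @ \<nu>) * (V \<mu> * x * star (V \<mu>))"
proof -
  have *: "P (\<mu> @ \<nu>) * V \<kappa> = 0" if "\<kappa> \<in> words_of_length n (length \<mu>) - {\<mu>}" for \<kappa>
  proof -
    have "P (\<mu> @ \<nu>) * V \<kappa> = V (\<mu> @ \<nu>) * star (V \<nu>) * (star (V \<mu>) * V \<kappa>)"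
      by (simp add: P_word_def S_word_append star_mult mult.assoc)
    moreover have "star (V \<mu>) * V \<kappa> = 0"
      using that assms by (subst V_same_length) (auto simp: words_of_length_def)
    ultimately show ?thesis by simp
  qed
  have "\<mu> \<in> words_of_length n (length \<mu>)" using assms by (simp add: words_of_length_def)
  moreover have "(\<Sum>\<kappa>\<in>words_of_length n (length \<mu>) - {\<mu>}. P (\<mu> @ \<nu>) * (V \<kappa> * x * star (V \<kappa>))) = 0"
    by (rule sum.neutral) (simp add: * flip: mult.assoc)
  moreover have "P (\<mu> @ \<nu>) * (\<phi> ^^ length \<mu>) x =
      (\<Sum>\<kappa>\<in>words_of_length n (length \<mu>). P (\<mu> @ \<nu>) * (V \<kappa> * x * star (V \<kappa>)))"
    by (simp add: canonical_shift_power sum_distrib_left)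
  ultimately show ?thesis by (simp add: sum.remove[of _ \<mu>])
qed

section \<open>The diagonal, its commutativity and its compressions\<close>

lemma D_subalgebra: "cstar_subalgebra D"
  unfolding cuntz_diagonal_def by (rule cstar_subalgebra_hull)

lemmas D_closed = cstar_subalgebraD(3-6)[OF D_subalgebra]

lemma P_in_D: "\<mu> \<in> W \<Longrightarrow> P \<mu> \<in> D"
  unfolding cuntz_diagonal_def by (intro hull_inc) auto

lemma one_in_D: "1 \<in> D"
  using P_in_D[of "[]"] by (simp add: P_word_def)

text \<open>Density arguments take this form: the elements with a given property are shown to be a
  C*-subalgebra, closedness included, so that only the \<open>P \<mu>\<close> remain to be
  checked.\<close>

lemma D_induct:
  assumes "x \<in> D" "cstar_subalgebra B" "\<And>\<mu>. \<mu> \<in> W \<Longrightarrow> P \<mu> \<in> B"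
  shows "x \<in> B"
  using assms cstar_subalgebra_hull_minimal[of B "P ` W" x] by (auto simp: cuntz_diagonal_def)

text \<open>Two words are nested or incomparable, so in either order the product is the smaller
  projection or 0.\<close>

lemma P_commute:
  assumes "\<mu> \<in> W" "\<nu> \<in> W"
  shows "P \<mu> * P \<nu> = P \<nu> * P \<mu>"
proof -
  consider \<kappa> where "\<nu> = \<mu> @ \<kappa>" | \<kappa> where "\<mu> = \<nu> @ \<kappa>" | "\<mu> \<parallel> \<nu>"
    by (meson prefixE parallelI)
  thus ?thesis
    by cases (use assms in \<open>auto simp: P_append_mult P_mult_append P_parallel parallel_commute\<close>)
qed

lemma D_commute_P:
  assumes "x \<in> D" "\<mu> \<in> W"
  shows "x * P \<mu> = P \<mu> * x"
proof -
  have "x \<in> {x. x * P \<mu> = P \<mu> * x}"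
  proof (rule D_induct[OF assms(1)])
    show "cstar_subalgebra {x. x * P \<mu> = P \<mu> * x}"
      unfolding cstar_subalgebra_def
    proof safe
      show "closed {x. x * P \<mu> = P \<mu> * x}" by (intro closed_Collect_eq continuous_intros)
      fix x assume x: "x * P \<mu> = P \<mu> * x"
      show "star x * P \<mu> = P \<mu> * star x" using arg_cong[OF x, of star] by (simp add: star_mult star_P_word)
      fix y assume "y * P \<mu> = P \<mu> * y"
      with x show "x * y * P \<mu> = P \<mu> * (x * y)" by (metis mult.assoc)
    qed (auto simp: algebra_simps mult_scaleC_left mult_scaleC_right)
  qed (use P_commute assms in auto)
  thus ?thesis by simp
qed

text \<open>Conjugation by an isometry is multiplicative, so the elements it sends into D form a
  C*-subalgebra; on generators it prepends \<mu> to the word.\<close>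

lemma conj_V_in_D:
  assumes "x \<in> D" "\<mu> \<in> W"
  shows "V \<mu> * x * star (V \<mu>) \<in> D"
proof -
  have "x \<in> {x. V \<mu> * x * star (V \<mu>) \<in> D}"
  proof (rule D_induct[OF assms(1)])
    show "cstar_subalgebra {x. V \<mu> * x * star (V \<mu>) \<in> D}"
      unfolding cstar_subalgebra_def
    proof safe
      show "closed {x. V \<mu> * x * star (V \<mu>) \<in> D}"
        using continuous_closed_preimage[of UNIV "\<lambda>x. V \<mu> * x * star (V \<mu>)" D]
          cstar_subalgebraD(1)[OF D_subalgebra]
        by (simp add: vimage_def continuous_intros)
      show "V \<mu> * 0 * star (V \<mu>) \<in> D" using cstar_subalgebraD(2)[OF D_subalgebra] by simp
      fix x assume x: "V \<mu> * x * star (V \<mu>) \<in> D"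
      show "V \<mu> * star x * star (V \<mu>) \<in> D" using D_closed(3)[OF x] by (simp add: star_mult star_star mult.assoc)
      show "V \<mu> * c *\<^sub>C x * star (V \<mu>) \<in> D" for c
        using D_closed(4)[OF x, of c] by (simp add: mult_scaleC_left mult_scaleC_right)
      fix y assume y: "V \<mu> * y * star (V \<mu>) \<in> D"
      show "V \<mu> * (x + y) * star (V \<mu>) \<in> D" using D_closed(1)[OF x y] by (simp add: algebra_simps)
      show "V \<mu> * (x * y) * star (V \<mu>) \<in> D"
        using D_closed(2)[OF x y] assms(2) by (simp add: mult.assoc V_isometry_mult)
    qed
  qed (use assms in \<open>auto simp: P_in_D simp flip: P_word_append\<close>)
  thus ?thesis by simp
qed

lemma shift_power_in_D: "x \<in> D \<Longrightarrow> (\<phi> ^^ k) x \<in> D"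
  unfolding canonical_shift_power
  by (rule cstar_subalgebra_sum[OF D_subalgebra]) (simp add: conj_V_in_D words_of_length_def)

text \<open>The compression of \<open>P \<nu>\<close> is the projection of the remaining tail, 1 or
  0, according to whether \<nu> extends \<mu>, is a prefix of \<mu>, or is incomparable with
  it.\<close>

lemma star_V_P_V_in_D:
  assumes "\<mu> \<in> W" "\<nu> \<in> W"
  shows "star (V \<mu>) * P \<nu> * V \<mu> \<in> D"
proof -
  consider \<kappa> where "\<nu> = \<mu> @ \<kappa>" | \<kappa> where "\<mu> = \<nu> @ \<kappa>" | "\<mu> \<parallel> \<nu>"
    by (meson prefixE parallelI)
  thus ?thesis
  proof cases
    case 1
    thus ?thesis using assms P_in_D[of \<kappa>] by (simp add: P_word_append mult.assoc V_isometry_mult V_isometry)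
  next
    case 2
    thus ?thesis using assms one_in_D by (simp add: P_mult_V_append V_isometry mult.assoc)
  next
    case 3
    thus ?thesis using assms cstar_subalgebraD(2)[OF D_subalgebra]
      by (simp add: P_word_def V_parallel flip: mult.assoc)
  qed
qed

text \<open>This compression is multiplicative on D because elements of D commute with
  \<open>P \<mu>\<close>; membership in D is therefore carried along in the induction.\<close>

lemma conj_star_V_in_D:
  assumes "x \<in> D" "\<mu> \<in> W"
  shows "star (V \<mu>) * x * V \<mu> \<in> D"
proof -
  have "x \<in> {x \<in> D. star (V \<mu>) * x * V \<mu> \<in> D}"
  proof (rule D_induct[OF assms(1)])
    show "cstar_subalgebra {x \<in> D. star (V \<mu>) * x * V \<mu> \<in> D}"
      unfolding cstar_subalgebra_def
    proof safe
      have "closed {x. star (V \<mu>) * x * V \<mu> \<in> D}"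
        using continuous_closed_preimage[of UNIV "\<lambda>x. star (V \<mu>) * x * V \<mu>" D]
          cstar_subalgebraD(1)[OF D_subalgebra]
        by (simp add: vimage_def continuous_intros)
      moreover have "{x \<in> D. star (V \<mu>) * x * V \<mu> \<in> D} = D \<inter> {x. star (V \<mu>) * x * V \<mu> \<in> D}" by auto
      ultimately show "closed {x \<in> D. star (V \<mu>) * x * V \<mu> \<in> D}"
        using cstar_subalgebraD(1)[OF D_subalgebra] by auto
      show "0 \<in> D" "star (V \<mu>) * 0 * V \<mu> \<in> D" using cstar_subalgebraD(2)[OF D_subalgebra] by simp_all
      fix x assume x': "x \<in> D" and x: "star (V \<mu>) * x * V \<mu> \<in> D"
      show "star (V \<mu>) * star x * V \<mu> \<in> D" using D_closed(3)[OF x] by (simp add: star_mult star_star mult.assoc)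
      show "star (V \<mu>) * c *\<^sub>C x * V \<mu> \<in> D" for c
        using D_closed(4)[OF x, of c] by (simp add: mult_scaleC_left mult_scaleC_right)
      fix y assume y': "y \<in> D" and y: "star (V \<mu>) * y * V \<mu> \<in> D"
      show "star (V \<mu>) * (x + y) * V \<mu> \<in> D" using D_closed(1)[OF x y] by (simp add: algebra_simps)
      have "(star (V \<mu>) * x * V \<mu>) * (star (V \<mu>) * y * V \<mu>) = star (V \<mu>) * (x * P \<mu>) * y * V \<mu>"
        by (simp add: P_word_def mult.assoc)
      also have "\<dots> = star (V \<mu>) * (x * y) * V \<mu>"
        using assms(2) by (simp add: D_commute_P[OF x'] star_V_mult_P flip: mult.assoc)
      finally show "star (V \<mu>) * (x * y) * V \<mu> \<in> D" using D_closed(2)[OF x y] by simp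
    qed (auto intro: D_closed)
  qed (use assms in \<open>auto simp: P_in_D star_V_P_V_in_D\<close>)
  thus ?thesis by simp
qed

section \<open>Projections of the diagonal\<close>

text \<open>When D is viewed as the continuous functions on the space of infinite words, this says
  that x varies little on every cylinder of a long word. The scalar may depend on the
  cylinder.\<close>

definition locally_scalar :: "'a \<Rightarrow> real \<Rightarrow> bool" where
  "locally_scalar x \<epsilon> \<longleftrightarrow>
     (\<exists>K. \<forall>\<mu>\<in>W. length \<mu> \<ge> K \<longrightarrow> (\<exists>c. norm (P \<mu> * x - c *\<^sub>C P \<mu>) < \<epsilon>))"

lemma locally_scalarE2:
  assumes "locally_scalar x \<epsilon>" "locally_scalar y \<delta>"
  obtains K where "\<And>\<mu>. \<mu> \<in> W \<Longrightarrow> length \<mu> \<ge> K \<Longrightarrow>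
    \<exists>c d. norm (P \<mu> * x - c *\<^sub>C P \<mu>) < \<epsilon> \<and> norm (P \<mu> * y - d *\<^sub>C P \<mu>) < \<delta>"
proof -
  from assms obtain K L
    where "\<forall>\<mu>\<in>W. length \<mu> \<ge> K \<longrightarrow> (\<exists>c. norm (P \<mu> * x - c *\<^sub>C P \<mu>) < \<epsilon>)"
      and "\<forall>\<mu>\<in>W. length \<mu> \<ge> L \<longrightarrow> (\<exists>c. norm (P \<mu> * y - c *\<^sub>C P \<mu>) < \<delta>)"
    unfolding locally_scalar_def by blast
  hence "\<exists>c d. norm (P \<mu> * x - c *\<^sub>C P \<mu>) < \<epsilon> \<and> norm (P \<mu> * y - d *\<^sub>C P \<mu>) < \<delta>"
    if "\<mu> \<in> W" "length \<mu> \<ge> max K L" for \<mu>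
    using that by simp
  thus ?thesis by (rule that)
qed

lemma norm_P: "\<mu> \<in> W \<Longrightarrow> norm (P \<mu>) = 1"
  by (simp add: norm_projection projection_P P_neq_0)

lemma norm_P_mult_le: "\<mu> \<in> W \<Longrightarrow> norm (P \<mu> * x) \<le> norm x"
  using norm_mult_ineq[of "P \<mu>" x] by (simp add: norm_P)

lemma locally_scalar_D:
  assumes "x \<in> D" "\<epsilon> > 0"
  shows "locally_scalar x \<epsilon>"
proof -
  \<comment> \<open>All tolerances are quantified together, because sums, multiples, products and
    limits call for smaller tolerances on their ingredients. Membership in D supplies the
    commutation used for \<open>star\<close>.\<close>
  let ?B = "{x \<in> D. \<forall>\<epsilon>>0. locally_scalar x \<epsilon>}"
  have "x \<in> ?B"
  proof (rule D_induct[OF assms(1)])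
    show "cstar_subalgebra ?B"
      unfolding cstar_subalgebra_def
    proof safe
      show "closed ?B"
        unfolding closed_sequential_limits
      proof safe
        fix X l assume X: "\<forall>k. X k \<in> ?B" and lim: "X \<longlonglongrightarrow> l"
        show "l \<in> D"
          using X closed_sequentially[OF cstar_subalgebraD(1)[OF D_subalgebra] _ lim] by blast
        fix \<epsilon> :: real assume e: "\<epsilon> > 0"
        from lim e obtain k where k: "dist (X k) l < \<epsilon> / 2"
          by (metis half_gt_zero lim_sequentially order_refl)
        from X e have "locally_scalar (X k) (\<epsilon> / 2)" by simp
        then obtain K where K: "\<And>\<mu>. \<mu> \<in> W \<Longrightarrow> length \<mu> \<ge> K \<Longrightarrow> \<exists>c. norm (P \<mu> * X k - c *\<^sub>C P \<mu>) < \<epsilon> / 2"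
          unfolding locally_scalar_def by blast
        show "locally_scalar l \<epsilon>"
          unfolding locally_scalar_def
        proof (rule exI[of _ K], intro ballI impI)
          fix \<mu> assume mu: "\<mu> \<in> W" "length \<mu> \<ge> K"
          from K[OF mu] obtain c where c: "norm (P \<mu> * X k - c *\<^sub>C P \<mu>) < \<epsilon> / 2" by blast
          have "norm (P \<mu> * (l - X k)) < \<epsilon> / 2"
            using norm_P_mult_le[OF mu(1), of "l - X k"] k by (simp add: dist_norm norm_minus_commute)
          with c have "norm (P \<mu> * (l - X k) + (P \<mu> * X k - c *\<^sub>C P \<mu>)) < \<epsilon>"
            using norm_triangle_ineq[of "P \<mu> * (l - X k)" "P \<mu> * X k - c *\<^sub>C P \<mu>"] by linarith
          moreover have "P \<mu> * (l - X k) + (P \<mu> * X k - c *\<^sub>C P \<mu>) = P \<mu> * l - c *\<^sub>C P \<mu>"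
            by (simp add: algebra_simps)
          ultimately have "norm (P \<mu> * l - c *\<^sub>C P \<mu>) < \<epsilon>" by simp
          thus "\<exists>c. norm (P \<mu> * l - c *\<^sub>C P \<mu>) < \<epsilon>" ..
        qed
      qed
      show "0 \<in> D" using cstar_subalgebraD(2)[OF D_subalgebra] .
      show "locally_scalar 0 \<epsilon>" if "\<epsilon> > 0" for \<epsilon>
        unfolding locally_scalar_def using that by (auto intro!: exI[of _ 0])
      fix x assume x': "x \<in> D" and x: "\<forall>\<epsilon>>0. locally_scalar x \<epsilon>"
      fix \<epsilon> :: real assume e: "\<epsilon> > 0"
      show "locally_scalar (star x) \<epsilon>"
        unfolding locally_scalar_def
      proof -
        from x e obtain K where K: "\<And>\<mu>. \<mu> \<in> W \<Longrightarrow> length \<mu> \<ge> K \<Longrightarrow> \<exists>c. norm (P \<mu> * x - c *\<^sub>C P \<mu>) < \<epsilon>"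
          unfolding locally_scalar_def by blast
        show "\<exists>K. \<forall>\<mu>\<in>W. length \<mu> \<ge> K \<longrightarrow> (\<exists>c. norm (P \<mu> * star x - c *\<^sub>C P \<mu>) < \<epsilon>)"
        proof (rule exI[of _ K], intro ballI impI)
          fix \<mu> assume mu: "\<mu> \<in> W" "length \<mu> \<ge> K"
          from K[OF mu] obtain c where c: "norm (P \<mu> * x - c *\<^sub>C P \<mu>) < \<epsilon>" by blast
          have "star (P \<mu> * x - c *\<^sub>C P \<mu>) = P \<mu> * star x - cnj c *\<^sub>C P \<mu>"
            using D_commute_P[OF D_closed(3)[OF x'] mu(1)]
            by (simp add: star_diff star_mult star_scaleC star_P_word)
          with c have "norm (P \<mu> * star x - cnj c *\<^sub>C P \<mu>) < \<epsilon>" by (metis norm_star)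
          thus "\<exists>c. norm (P \<mu> * star x - c *\<^sub>C P \<mu>) < \<epsilon>" ..
        qed
      qed
      show "locally_scalar (c *\<^sub>C x) \<epsilon>" for c
      proof -
        have "\<epsilon> / (cmod c + 1) > 0" using e by (simp add: add_nonneg_pos)
        with x obtain K where K: "\<And>\<mu>. \<mu> \<in> W \<Longrightarrow> length \<mu> \<ge> K \<Longrightarrow>
            \<exists>d. norm (P \<mu> * x - d *\<^sub>C P \<mu>) < \<epsilon> / (cmod c + 1)"
          unfolding locally_scalar_def by blast
        show ?thesis unfolding locally_scalar_def
        proof (rule exI[of _ K], intro ballI impI)
          fix \<mu> assume mu: "\<mu> \<in> W" "length \<mu> \<ge> K"
          from K[OF mu] obtain d where d: "norm (P \<mu> * x - d *\<^sub>C P \<mu>) < \<epsilon> / (cmod c + 1)" by blast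
          have "norm (P \<mu> * c *\<^sub>C x - (c * d) *\<^sub>C P \<mu>) = cmod c * norm (P \<mu> * x - d *\<^sub>C P \<mu>)"
            by (simp add: mult_scaleC_right scaleC_diff_right scaleC_scaleC flip: norm_scaleC)
          also have "\<dots> \<le> (cmod c + 1) * norm (P \<mu> * x - d *\<^sub>C P \<mu>)"
            by (intro mult_right_mono) auto
          also have "\<dots> < \<epsilon>" using d by (simp add: pos_less_divide_eq add_nonneg_pos mult.commute)
          finally show "\<exists>d. norm (P \<mu> * c *\<^sub>C x - d *\<^sub>C P \<mu>) < \<epsilon>" ..
        qed
      qed
      fix y assume y': "y \<in> D" and y: "\<forall>\<epsilon>>0. locally_scalar y \<epsilon>"
      show "locally_scalar (x + y) \<epsilon>"
      proof -
        have "\<epsilon> / 2 > 0" using e by simp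
        with x y obtain K where K: "\<And>\<mu>. \<mu> \<in> W \<Longrightarrow> length \<mu> \<ge> K \<Longrightarrow>
            \<exists>c d. norm (P \<mu> * x - c *\<^sub>C P \<mu>) < \<epsilon> / 2 \<and> norm (P \<mu> * y - d *\<^sub>C P \<mu>) < \<epsilon> / 2"
          by (metis locally_scalarE2)
        show ?thesis unfolding locally_scalar_def
        proof (rule exI[of _ K], intro ballI impI)
          fix \<mu> assume mu: "\<mu> \<in> W" "length \<mu> \<ge> K"
          from K[OF mu] obtain c d where cd: "norm (P \<mu> * x - c *\<^sub>C P \<mu>) < \<epsilon> / 2"
            "norm (P \<mu> * y - d *\<^sub>C P \<mu>) < \<epsilon> / 2" by blast
          have "norm ((P \<mu> * x - c *\<^sub>C P \<mu>) + (P \<mu> * y - d *\<^sub>C P \<mu>)) < \<epsilon>"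
            using cd norm_triangle_ineq[of "P \<mu> * x - c *\<^sub>C P \<mu>" "P \<mu> * y - d *\<^sub>C P \<mu>"] by linarith
          hence "norm (P \<mu> * (x + y) - (c + d) *\<^sub>C P \<mu>) < \<epsilon>"
            by (simp add: algebra_simps scaleC_add_left)
          thus "\<exists>c. norm (P \<mu> * (x + y) - c *\<^sub>C P \<mu>) < \<epsilon>" ..
        qed
      qed
      show "locally_scalar (x * y) \<epsilon>"
      proof -
        have half: "\<epsilon> / 2 / a * a = \<epsilon> / 2" if "a > 0" for a :: real using that by simp
        \<comment> \<open>The error of a product splits as
          \<open>(P \<mu> * x - c *\<^sub>C P \<mu>) * y\<close> plus
          \<open>c *\<^sub>C (P \<mu> * y - d *\<^sub>C P \<mu>)\<close>. The bound on |c| involves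
          \<epsilon>1, so \<epsilon>2 is chosen after it; the 1 added to \<open>norm y\<close> keeps
          the denominator positive.\<close>
        define \<epsilon>1 where "\<epsilon>1 = \<epsilon> / 2 / (norm y + 1)"
        define \<epsilon>2 where "\<epsilon>2 = \<epsilon> / 2 / (norm x + \<epsilon>1 + 1)"
        have e1: "\<epsilon>1 > 0" using e by (simp add: \<epsilon>1_def add_nonneg_pos)
        hence e2: "\<epsilon>2 > 0" using e by (simp add: \<epsilon>2_def add_nonneg_pos)
        from x y e1 e2 obtain K where K: "\<And>\<mu>. \<mu> \<in> W \<Longrightarrow> length \<mu> \<ge> K \<Longrightarrow>
            \<exists>c d. norm (P \<mu> * x - c *\<^sub>C P \<mu>) < \<epsilon>1 \<and> norm (P \<mu> * y - d *\<^sub>C P \<mu>) < \<epsilon>2"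
          by (metis locally_scalarE2)
        show ?thesis unfolding locally_scalar_def
        proof (rule exI[of _ K], intro ballI impI)
          fix \<mu> assume mu: "\<mu> \<in> W" "length \<mu> \<ge> K"
          from K[OF mu] obtain c d where cd: "norm (P \<mu> * x - c *\<^sub>C P \<mu>) < \<epsilon>1"
            "norm (P \<mu> * y - d *\<^sub>C P \<mu>) < \<epsilon>2" by blast
          have "cmod c = norm (c *\<^sub>C P \<mu>)" using mu by (simp add: norm_scaleC norm_P)
          also have "\<dots> \<le> norm (P \<mu> * x) + norm (P \<mu> * x - c *\<^sub>C P \<mu>)"
            by (metis norm_minus_commute norm_triangle_sub)
          finally have c: "cmod c \<le> norm x + \<epsilon>1 + 1"
            using norm_P_mult_le[OF mu(1), of x] cd(1) by linarith
          have "norm ((P \<mu> * x - c *\<^sub>C P \<mu>) * y) \<le> \<epsilon>1 * (norm y + 1)"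
            using cd(1) e1 by (intro order_trans[OF norm_mult_ineq] mult_mono) auto
          moreover have "\<epsilon>1 * (norm y + 1) = \<epsilon> / 2"
            unfolding \<epsilon>1_def by (rule half) (simp add: add_nonneg_pos)
          moreover have "norm (c *\<^sub>C (P \<mu> * y - d *\<^sub>C P \<mu>)) < \<epsilon> / 2"
          proof -
            have "norm (c *\<^sub>C (P \<mu> * y - d *\<^sub>C P \<mu>)) \<le> (norm x + \<epsilon>1 + 1) * norm (P \<mu> * y - d *\<^sub>C P \<mu>)"
              using c by (simp add: norm_scaleC mult_right_mono)
            also have "\<dots> < (norm x + \<epsilon>1 + 1) * \<epsilon>2"
              using cd(2) e1 by (intro mult_strict_left_mono) (auto simp: add_nonneg_pos)
            also have "\<dots> = \<epsilon> / 2"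
              unfolding \<epsilon>2_def by (subst mult.commute, rule half) (use e1 norm_ge_zero[of x] in linarith)
            finally show ?thesis .
          qed
          ultimately have "norm ((P \<mu> * x - c *\<^sub>C P \<mu>) * y + c *\<^sub>C (P \<mu> * y - d *\<^sub>C P \<mu>)) < \<epsilon>"
            using norm_triangle_ineq[of "(P \<mu> * x - c *\<^sub>C P \<mu>) * y" "c *\<^sub>C (P \<mu> * y - d *\<^sub>C P \<mu>)"]
            by linarith
          hence "norm (P \<mu> * (x * y) - (c * d) *\<^sub>C P \<mu>) < \<epsilon>"
            by (simp add: algebra_simps mult_scaleC_left scaleC_diff_right scaleC_scaleC)
          thus "\<exists>c. norm (P \<mu> * (x * y) - c *\<^sub>C P \<mu>) < \<epsilon>" ..
        qed
      qed
    qed (auto intro: D_closed)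
  next
    fix \<nu> assume nu: "\<nu> \<in> W"
    have "\<exists>c. P \<mu> * P \<nu> = c *\<^sub>C P \<mu>" if mu: "\<mu> \<in> W" "length \<mu> \<ge> length \<nu>" for \<mu>
    proof -
      \<comment> \<open>Since \<nu> is no longer than \<mu>, below \<open>P \<mu>\<close> the
        projection \<open>P \<nu>\<close> is exactly the scalar 1 or 0.\<close>
      consider \<kappa> where "\<mu> = \<nu> @ \<kappa>" | "\<mu> \<parallel> \<nu>"
        using mu(2) by (metis parallelI prefixE prefix_length_prefix prefix_order.refl)
      thus ?thesis
      proof cases
        case 1
        hence "P \<mu> * P \<nu> = 1 *\<^sub>C P \<mu>" using mu by (simp add: P_append_mult)
        thus ?thesis by blast
      next
        case 2
        hence "P \<mu> * P \<nu> = 0 *\<^sub>C P \<mu>"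
          using mu nu by (simp add: P_parallel)
        thus ?thesis by blast
      qed
    qed
    hence "locally_scalar (P \<nu>) \<epsilon>" if "\<epsilon> > 0" for \<epsilon>
      unfolding locally_scalar_def using that by (intro exI[of _ "length \<nu>"]) (metis diff_self norm_zero)
    thus "P \<nu> \<in> ?B" using nu by (simp add: P_in_D)
  qed
  thus ?thesis using assms(2) by simp
qed

text \<open>If \<open>P \<mu> * p\<close> and its complement in \<open>P \<mu>\<close> are both
  nonzero, both have norm 1. A scalar c approximating p on \<open>P \<mu>\<close> within 1/2 would
  then be within 1/2 of both 1 and 0, which is impossible.\<close>

lemma projection_eventually_scalar:
  assumes "p \<in> D" "projection p"
  shows "\<exists>K. \<forall>\<mu>\<in>W. length \<mu> \<ge> K \<longrightarrow> P \<mu> * p = 0 \<or> P \<mu> * p = P \<mu>"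
proof -
  from locally_scalar_D[OF assms(1), of "1/2"] obtain K
    where K: "\<And>\<mu>. \<mu> \<in> W \<Longrightarrow> length \<mu> \<ge> K \<Longrightarrow> \<exists>c. norm (P \<mu> * p - c *\<^sub>C P \<mu>) < 1/2"
    by (auto simp: locally_scalar_def)
  have "P \<mu> * p = 0 \<or> P \<mu> * p = P \<mu>" if mu: "\<mu> \<in> W" "length \<mu> \<ge> K" for \<mu>
  proof (rule ccontr)
    assume neg: "\<not> (P \<mu> * p = 0 \<or> P \<mu> * p = P \<mu>)"
    from K[OF mu] obtain c where c: "norm (P \<mu> * p - c *\<^sub>C P \<mu>) < 1/2" by blast
    define q where "q = P \<mu> * p"
    note comm = D_commute_P[OF assms(1) mu(1)]
    have pp: "p * p = p" "star p = p" using assms(2) by (auto simp: projection_def)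
    have qq: "q * q = q"
    proof -
      have "q * q = P \<mu> * (p * P \<mu>) * p" by (simp add: q_def mult.assoc)
      also have "\<dots> = (P \<mu> * P \<mu>) * (p * p)" by (simp add: comm mult.assoc)
      finally show ?thesis using mu by (simp add: pp P_idem q_def)
    qed
    have Pq: "P \<mu> * q = q" using mu by (simp add: q_def P_idem flip: mult.assoc)
    have qP: "q * P \<mu> = q" using Pq by (simp add: q_def mult.assoc comm)
    have sq: "star q = q" by (simp add: q_def star_mult pp star_P_word comm)
    have q: "norm q = 1" using neg by (intro norm_projection) (auto simp: projection_def qq sq q_def[symmetric])
    have "projection (P \<mu> - q)" using mu
      by (simp add: projection_def algebra_simps qq Pq qP P_idem sq star_diff star_P_word)
    hence r: "norm (P \<mu> - q) = 1" using neg by (intro norm_projection) (auto simp: q_def)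
    have "q * (q - c *\<^sub>C P \<mu>) = (1 - c) *\<^sub>C q"
      by (simp add: right_diff_distrib mult_scaleC_right qq qP scaleC_diff_left)
    moreover have "norm (q * (q - c *\<^sub>C P \<mu>)) < 1/2"
      using norm_mult_ineq[of q "q - c *\<^sub>C P \<mu>"] c q by (simp add: q_def)
    ultimately have 1: "cmod (1 - c) < 1/2" by (simp add: norm_scaleC q)
    have "(P \<mu> - q) * (q - c *\<^sub>C P \<mu>) = (- c) *\<^sub>C (P \<mu> - q)"
    proof -
      have "(P \<mu> - q) * q = 0" "(P \<mu> - q) * P \<mu> = P \<mu> - q"
        using mu by (simp_all add: left_diff_distrib qq qP Pq P_idem)
      thus ?thesis by (simp only: right_diff_distrib mult_scaleC_right scaleC_minus_left) simp
    qed
    moreover have "norm ((P \<mu> - q) * (q - c *\<^sub>C P \<mu>)) < 1/2"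
      using norm_mult_ineq[of "P \<mu> - q" "q - c *\<^sub>C P \<mu>"] c r by (simp add: q_def)
    ultimately have 2: "cmod c < 1/2" by (simp add: norm_scaleC r)
    show False using 1 2 norm_triangle_ineq[of "1 - c" c] by simp
  qed
  thus ?thesis by blast
qed

section \<open>Inner automorphisms\<close>

lemma sum_list_orthonormal:
  assumes "\<And>a b. a \<in> set as \<Longrightarrow> b \<in> set bs \<Longrightarrow> star (g a) * g b = (if a = b then 1 else (0::'a))"
  shows "star (\<Sum>a\<leftarrow>as. g a) * (\<Sum>b\<leftarrow>bs. g b) = of_nat (\<Sum>a\<leftarrow>as. count_list bs a)"
  using assms
proof (induction as)
  case (Cons a as)
  have "star (g a) * (\<Sum>b\<leftarrow>bs. g b) = of_nat (count_list bs a)"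
    using Cons.prems by (induction bs) (auto simp: distrib_left)
  with Cons show ?case by (simp add: star_add distrib_right)
qed simp

text \<open>Appending \<open>1 2 2 \<dots> 2\<close> makes distinct words incomparable, which turns the isometry relation
  into a count of the coincidences in the list.\<close>

lemma sum_list_isometry_single:
  assumes n: "n \<ge> 2" and as: "as \<in> lists W" and iso: "star v * v = 1" and v: "v = (\<Sum>a\<leftarrow>as. V a)"
  shows "\<exists>\<alpha>\<in>W. v = V \<alpha>"
proof -
  have "finite (length ` set as)" by simp
  then obtain K where K: "\<forall>a\<in>set as. length a \<le> K"
    unfolding finite_nat_set_iff_bounded_le by auto
  define \<delta> :: "nat list" where "\<delta> = 1 # replicate K 2"
  have \<delta>: "\<delta> \<in> W" using n by (auto simp: \<delta>_def cuntz_words_def)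
  have not_prefix: "\<not> prefix (a @ \<delta>) (b @ \<delta>)" if "a \<in> set as" "b \<in> set as" "a \<noteq> b" for a b
  proof
    assume pre: "prefix (a @ \<delta>) (b @ \<delta>)"
    hence le: "length a \<le> length b" using prefix_length_le by fastforce
    have nth: "(b @ \<delta>) ! i = (a @ \<delta>) ! i" if "i < length (a @ \<delta>)" for i
    proof -
      from pre obtain zs where zs: "b @ \<delta> = (a @ \<delta>) @ zs" by (auto simp: prefix_def)
      show ?thesis unfolding zs nth_append[of "a @ \<delta>"] using that by simp
    qed
    show False
    proof (cases "length a = length b")
      case True
      with pre \<open>a \<noteq> b\<close> show False by (auto simp: prefix_def)
    next
      case False
      with le have lt: "length a < length b" by simp
      \<comment> \<open>At position \<open>length b\<close> the word \<open>b @ \<delta>\<close> has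
        the initial 1 of \<delta>, whereas \<open>a @ \<delta>\<close> is already among the
        2s.\<close>
      moreover have "length b < length (a @ \<delta>)" using K that by (auto simp: \<delta>_def le_imp_less_Suc trans_le_add2)
      ultimately have "\<delta> ! 0 = \<delta> ! (length b - length a)"
        using nth[of "length b"] by (simp add: nth_append)
      moreover have "length b - length a \<le> K" using K that by (meson diff_le_self le_trans)
      ultimately show False using lt by (simp add: \<delta>_def nth_Cons')
    qed
  qed
  have orth: "star (V a * V \<delta>) * (V b * V \<delta>) = (if a = b then 1 else 0)"
    if "a \<in> set as" "b \<in> set as" for a b
  proof -
    have ab: "a @ \<delta> \<in> W" "b @ \<delta> \<in> W" using that as \<delta> by auto
    show ?thesis
    proof (cases "a = b")
      case True
      thus ?thesis using V_isometry[OF ab(1)] by (simp add: S_word_append)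
    next
      case False
      thus ?thesis using V_parallel[OF ab] not_prefix that
        by (simp add: S_word_append parallelI)
    qed
  qed
  have sum: "(\<Sum>a\<leftarrow>as. V a * V \<delta>) = v * V \<delta>" by (simp add: v sum_list_mult_const)
  have "of_nat (\<Sum>a\<leftarrow>as. count_list as a) = star (v * V \<delta>) * (v * V \<delta>)"
    using sum_list_orthonormal[of as as "\<lambda>a. V a * V \<delta>"] orth by (simp add: sum)
  also have "\<dots> = star (V \<delta>) * (star v * v) * V \<delta>" by (simp add: star_mult mult.assoc)
  also have "\<dots> = of_nat 1" by (simp add: iso V_isometry \<delta>)
  finally have one: "(\<Sum>a\<leftarrow>as. count_list as a) = 1" by (simp only: of_nat_eq_iff)
  \<comment> \<open>Every entry coincides at least with itself, so the count, which is 1, bounds the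
    length of the list.\<close>
  have "(\<Sum>a\<leftarrow>as. 1) \<le> (\<Sum>a\<leftarrow>as. count_list as a)"
    by (rule sum_list_mono) (simp add: Suc_le_eq count_list_0_iff[THEN arg_cong[of _ _ Not]] flip: neq0_conv)
  hence "length as \<le> 1" by (simp add: one sum_list_triv)
  moreover have "as \<noteq> []" using one by auto
  ultimately obtain a where "as = [a]" by (cases as) auto
  with v as show ?thesis by auto
qed

text \<open>A word \<nu> at least as long as every \<beta> absorbs each
  \<open>star (V \<beta>)\<close>: a tail of \<nu> remains if \<beta> is a prefix, and otherwise the
  term vanishes. No adjoint survives, as \<open>sum_list_isometry_single\<close> requires.\<close>

lemma sum_list_mult_V:
  assumes "ps \<in> lists (W \<times> W)" "\<nu> \<in> W" "\<And>\<alpha> \<beta>. (\<alpha>, \<beta>) \<in> set ps \<Longrightarrow> length \<beta> \<le> length \<nu>"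
  shows "\<exists>as\<in>lists W. (\<Sum>(\<alpha>, \<beta>)\<leftarrow>ps. V \<alpha> * star (V \<beta>)) * V \<nu> = (\<Sum>a\<leftarrow>as. V a)"
  using assms(1,3)
proof (induction ps rule: lists.induct)
  case Nil
  show ?case by (intro bexI[of _ "[]"]) auto
next
  case (Cons p ps)
  obtain \<alpha> \<beta> where p: "p = (\<alpha>, \<beta>)" by force
  from Cons obtain as where as: "as \<in> lists W"
    "(\<Sum>(\<alpha>, \<beta>)\<leftarrow>ps. V \<alpha> * star (V \<beta>)) * V \<nu> = (\<Sum>a\<leftarrow>as. V a)" by auto
  have mem: "\<alpha> \<in> W" "\<beta> \<in> W" and le: "length \<beta> \<le> length \<nu>"
    using Cons.hyps(1) Cons.prems[of \<alpha> \<beta>] by (auto simp: p)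
  consider \<gamma> where "\<nu> = \<beta> @ \<gamma>" | "\<beta> \<parallel> \<nu>"
    using le by (metis parallelI prefixE prefix_length_prefix prefix_order.refl)
  thus ?case
  proof cases
    case 1
    hence "V \<alpha> * star (V \<beta>) * V \<nu> = V (\<alpha> @ \<gamma>)"
      using mem by (simp add: S_word_append mult.assoc V_isometry_mult)
    thus ?thesis using as mem 1 assms(2)
      by (intro bexI[of _ "(\<alpha> @ \<gamma>) # as"]) (auto simp: p distrib_right)
  next
    case 2
    hence "V \<alpha> * star (V \<beta>) * V \<nu> = 0" using mem assms(2) by (simp add: V_parallel mult.assoc)
    thus ?thesis using as by (intro bexI[of _ as]) (auto simp: p distrib_right)
  qed
qed

text \<open>L bounds the right-hand words in one representation of u. Then
  \<open>u * V \<beta>\<close> is a sum of elements \<open>V a\<close> and, u being unitary, an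
  isometry, so there is only one summand.\<close>

lemma cuntz_unitary_maps_words:
  assumes n: "n \<ge> 2" and u: "u \<in> cuntz_unitary_group n S"
  shows "\<exists>L. \<exists>\<sigma>. \<forall>\<beta>\<in>words_of_length n L. \<sigma> \<beta> \<in> W \<and> u * V \<beta> = V (\<sigma> \<beta>)"
proof -
  from u obtain ps where ps: "ps \<in> lists (W \<times> W)" and u_eq: "u = (\<Sum>(\<alpha>, \<beta>)\<leftarrow>ps. V \<alpha> * star (V \<beta>))"
    by (auto simp: cuntz_unitary_group_def)
  have "finite ((\<lambda>p. length (snd p)) ` set ps)" by simp
  then obtain L where "\<forall>p\<in>set ps. length (snd p) \<le> L"
    unfolding finite_nat_set_iff_bounded_le by auto
  hence L: "length \<beta> \<le> L" if "(\<alpha>, \<beta>) \<in> set ps" for \<alpha> \<beta>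
    using that by force
  have "\<exists>\<alpha>\<in>W. u * V \<beta> = V \<alpha>" if b: "\<beta> \<in> words_of_length n L" for \<beta>
  proof -
    have bW: "\<beta> \<in> W" using b by (simp add: words_of_length_def)
    obtain as where as: "as \<in> lists W" "u * V \<beta> = (\<Sum>a\<leftarrow>as. V a)"
      using sum_list_mult_V[OF ps bW] L b by (auto simp: u_eq words_of_length_def)
    have "star (u * V \<beta>) * (u * V \<beta>) = star (V \<beta>) * (star u * u) * V \<beta>"
      by (simp add: star_mult mult.assoc)
    also have "\<dots> = 1" using u bW by (simp add: cuntz_unitary_group_def unitary_def V_isometry)
    finally show ?thesis using sum_list_isometry_single[OF n as(1) _ as(2)] by simp
  qed
  thus ?thesis by metis
qed

text \<open>Conjugation by u replaces a prefix \<beta> of length L by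
  \<open>\<sigma> \<beta>\<close> and keeps the tail. Hence words of length at least L have standard
  images, and the relations hold with all k equal to L and with m the length of
  \<open>\<sigma> \<beta>\<close>, which may vary with \<beta>.\<close>

lemma inner_imp_conditions:
  assumes n: "n \<ge> 2" and u: "u \<in> cuntz_unitary_group n S" and f: "\<And>x. x \<in> D \<Longrightarrow> f x = Ad u x"
  shows "eventually_preserves_standard_projections n S f"
    and "\<exists>(r::nat) R Q (k :: nat \<Rightarrow> nat) (m :: nat \<Rightarrow> nat).
        (\<forall>i\<in>{1..r}. R i \<in> D \<and> projection (R i) \<and> Q i \<in> D \<and> projection (Q i)) \<and>
        (\<Sum>i=1..r. R i) = 1 \<and> (\<Sum>i=1..r. Q i) = 1 \<and>
        (\<forall>i\<in>{1..r}. \<forall>x\<in>D. f (R i * (\<phi> ^^ k i) x) = Q i * (\<phi> ^^ m i) x)"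
proof -
  obtain L \<sigma> where \<sigma>: "\<And>\<beta>. \<beta> \<in> words_of_length n L \<Longrightarrow> \<sigma> \<beta> \<in> W"
    and uV: "\<And>\<beta>. \<beta> \<in> words_of_length n L \<Longrightarrow> u * V \<beta> = V (\<sigma> \<beta>)"
    using cuntz_unitary_maps_words[OF n u] by blast
  have Ad: "Ad u (V \<beta> * x * star (V \<beta>)) = V (\<sigma> \<beta>) * x * star (V (\<sigma> \<beta>))"
    if "\<beta> \<in> words_of_length n L" for \<beta> x
  proof -
    have "Ad u (V \<beta> * x * star (V \<beta>)) = (u * V \<beta>) * x * star (u * V \<beta>)"
      by (simp add: Ad_def star_mult mult.assoc)
    thus ?thesis by (simp add: uV that)
  qed
  show "eventually_preserves_standard_projections n S f"
    unfolding eventually_preserves_standard_projections_def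
  proof (intro exI ballI impI)
    fix \<alpha> assume a: "\<alpha> \<in> W" "length \<alpha> \<ge> L"
    define \<beta> \<gamma> where "\<beta> = take L \<alpha>" and "\<gamma> = drop L \<alpha>"
    have b: "\<beta> \<in> words_of_length n L" "\<gamma> \<in> W" and \<alpha>: "\<alpha> = \<beta> @ \<gamma>"
      using a by (auto simp: \<beta>_def \<gamma>_def words_of_length_def)
    have "f (P \<alpha>) = Ad u (P \<alpha>)" using a by (simp add: f P_in_D)
    also have "\<dots> = P (\<sigma> \<beta> @ \<gamma>)" by (simp add: \<alpha> P_word_append Ad[OF b(1)])
    finally show "f (P \<alpha>) \<in> standard_projections n S"
      using \<sigma>[OF b(1)] b(2) by (simp add: standard_projections_def)
  qed
  define r where "r = card (words_of_length n L)"
  obtain h where h: "bij_betw h {1..r} (words_of_length n L)"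
    using ex_bij_betw_nat_finite_1[of "words_of_length n L"] by (auto simp: r_def)
  hence hW: "h i \<in> words_of_length n L" if "i \<in> {1..r}" for i
    using that by (auto simp: bij_betw_def)
  have sum_eq: "(\<Sum>i=1..r. P (h i)) = 1"
    using sum.reindex_bij_betw[OF h, of P] by (simp add: sum_P)
  have "P (\<sigma> (h i)) = u * P (h i) * star u" if "i \<in> {1..r}" for i
    using Ad[OF hW[OF that], of 1] by (simp add: P_word_def Ad_def)
  hence "(\<Sum>i=1..r. P (\<sigma> (h i))) = (\<Sum>i=1..r. u * P (h i) * star u)" by (intro sum.cong) auto
  also have "\<dots> = u * star u" unfolding sum_distrib_right[symmetric] sum_distrib_left[symmetric] sum_eq by simp
  also have "\<dots> = 1" using u by (simp add: cuntz_unitary_group_def unitary_def)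
  finally have sum_eq': "(\<Sum>i=1..r. P (\<sigma> (h i))) = 1" .
  have main: "f (P (h i) * (\<phi> ^^ L) x) = P (\<sigma> (h i)) * (\<phi> ^^ length (\<sigma> (h i))) x"
    if i: "i \<in> {1..r}" and x: "x \<in> D" for i x
  proof -
    have W': "h i \<in> W" "length (h i) = L" using hW[OF i] by (auto simp: words_of_length_def)
    have PV: "P \<mu> * (V \<mu> * x * star (V \<mu>)) = V \<mu> * x * star (V \<mu>)" if "\<mu> \<in> W" for \<mu>
      using that by (simp add: P_mult_V flip: mult.assoc)
    have "P (h i) * (\<phi> ^^ L) x = V (h i) * x * star (V (h i))"
      using P_mult_shift_power[of "h i" "[]" x] W' by (simp add: PV)
    hence "f (P (h i) * (\<phi> ^^ L) x) = Ad u (V (h i) * x * star (V (h i)))"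
      using W' x by (simp add: f conj_V_in_D)
    also have "\<dots> = V (\<sigma> (h i)) * x * star (V (\<sigma> (h i)))" by (rule Ad[OF hW[OF i]])
    also have "\<dots> = P (\<sigma> (h i)) * (\<phi> ^^ length (\<sigma> (h i))) x"
      using P_mult_shift_power[of "\<sigma> (h i)" "[]" x] \<sigma>[OF hW[OF i]] by (simp add: PV)
    finally show ?thesis .
  qed
  show "\<exists>(r::nat) R Q (k :: nat \<Rightarrow> nat) (m :: nat \<Rightarrow> nat).
        (\<forall>i\<in>{1..r}. R i \<in> D \<and> projection (R i) \<and> Q i \<in> D \<and> projection (Q i)) \<and>
        (\<Sum>i=1..r. R i) = 1 \<and> (\<Sum>i=1..r. Q i) = 1 \<and>
        (\<forall>i\<in>{1..r}. \<forall>x\<in>D. f (R i * (\<phi> ^^ k i) x) = Q i * (\<phi> ^^ m i) x)"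
  proof (intro exI conjI ballI)
    show "f (P (h i) * (\<phi> ^^ L) x) = P (\<sigma> (h i)) * (\<phi> ^^ length (\<sigma> (h i))) x"
      if "i \<in> {1..r}" "x \<in> D" for i x using main that .
    show "(\<Sum>i=1..r. P (h i)) = 1" "(\<Sum>i=1..r. P (\<sigma> (h i))) = 1" by fact+
    fix i assume "i \<in> {1..r}"
    hence "h i \<in> W" "\<sigma> (h i) \<in> W" using hW \<sigma> by (auto simp: words_of_length_def)
    thus "P (h i) \<in> D" "projection (P (h i))" "P (\<sigma> (h i)) \<in> D" "projection (P (\<sigma> (h i)))"
      by (simp_all add: P_in_D projection_P)
  qed
qed

section \<open>From the two conditions to an implementing unitary\<close>

text \<open>The candidate u is the sum of all \<open>V (\<sigma> \<mu>) * star (V \<mu>)\<close>.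
  Cutting x into the pieces \<open>P \<mu> * x\<close> shows that u implements f. Then
  \<open>u * star u\<close> equals \<open>f 1\<close>, and \<open>star u * u\<close> is computed
  from the orthogonality of the \<open>P (\<sigma> \<mu>)\<close>, inherited through f.\<close>

lemma inner_of_word_map:
  assumes n: "n \<ge> 1" and f: "cstar_automorphism_on D f"
    and \<sigma>: "\<And>\<mu>. \<mu> \<in> words_of_length n K \<Longrightarrow> \<sigma> \<mu> \<in> W"
    and f_conj: "\<And>\<mu> y. \<mu> \<in> words_of_length n K \<Longrightarrow> y \<in> D \<Longrightarrow>
      f (V \<mu> * y * star (V \<mu>)) = V (\<sigma> \<mu>) * y * star (V (\<sigma> \<mu>))"
  shows "\<exists>u\<in>cuntz_unitary_group n S. \<forall>x\<in>D. f x = Ad u x"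
proof -
  let ?K = "words_of_length n K"
  have KW: "\<mu> \<in> W" if "\<mu> \<in> ?K" for \<mu> using that by (simp add: words_of_length_def)
  define u where "u = (\<Sum>\<mu>\<in>?K. V (\<sigma> \<mu>) * star (V \<mu>))"
  have D0: "0 \<in> D" by (rule cstar_subalgebraD(2)[OF D_subalgebra])
  have f_add: "f (x + y) = f x + f y" and f_mult: "f (x * y) = f x * f y" if "x \<in> D" "y \<in> D" for x y
    using f that by (auto simp: cstar_automorphism_on_def)
  have f0: "f 0 = 0" using f_add[OF D0 D0] by simp
  have f_sum: "f (\<Sum>i\<in>A. g i) = (\<Sum>i\<in>A. f (g i))" if "\<And>i. i \<in> A \<Longrightarrow> g i \<in> D" for g and A :: "nat list set"
    using that
    by (induction A rule: infinite_finite_induct)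
      (auto simp: f0 f_add cstar_subalgebra_sum[OF D_subalgebra])
  have bij: "bij_betw f D D" using f by (simp add: cstar_automorphism_on_def)
  \<comment> \<open>Preservation of the unit is drawn from surjectivity: if \<open>f y = 1\<close>,
    then \<open>f 1 = f 1 * f y = f y\<close>.\<close>
  have f1: "f 1 = 1"
  proof -
    obtain y where y: "y \<in> D" "f y = 1" using bij one_in_D by (metis bij_betw_def imageE)
    have "f 1 = f 1 * f y" using y by simp
    also have "\<dots> = 1" using f_mult[OF one_in_D y(1)] y by simp
    finally show ?thesis .
  qed
  have orth: "star (V \<mu>) * x * V \<nu> = 0" if "\<mu> \<in> ?K" "\<nu> \<in> ?K" "\<nu> \<noteq> \<mu>" "x \<in> D" for \<mu> \<nu> x
  proof -
    \<comment> \<open>\<open>P \<mu>\<close> is inserted to the left of x and commuted to the right,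
      where it meets \<open>V \<nu>\<close>.\<close>
    have "star (V \<mu>) * x * V \<nu> = star (V \<mu>) * (P \<mu> * x) * V \<nu>"
      using star_V_mult_P[OF KW[OF that(1)]] by (simp flip: mult.assoc)
    also have "\<dots> = star (V \<mu>) * x * V \<mu> * (star (V \<mu>) * V \<nu>)"
      unfolding D_commute_P[OF that(4) KW[OF that(1)], symmetric] by (simp add: P_word_def mult.assoc)
    also have "star (V \<mu>) * V \<nu> = 0"
      using that by (subst V_same_length) (auto simp: words_of_length_def)
    finally show ?thesis by simp
  qed
  have fP: "f (P \<mu>) = P (\<sigma> \<mu>)" if "\<mu> \<in> ?K" for \<mu>
    using f_conj[OF that one_in_D] by (simp add: P_word_def)
  have orth': "star (V (\<sigma> \<mu>)) * V (\<sigma> \<nu>) = 0" if "\<mu> \<in> ?K" "\<nu> \<in> ?K" "\<nu> \<noteq> \<mu>" for \<mu> \<nu>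
  proof -
    have "P \<mu> * P \<nu> = V \<mu> * (star (V \<mu>) * 1 * V \<nu>) * star (V \<nu>)" by (simp add: P_word_def mult.assoc)
    also have "\<dots> = 0" by (simp only: orth[OF that one_in_D] mult_zero_left mult_zero_right)
    finally have "P (\<sigma> \<mu>) * P (\<sigma> \<nu>) = 0"
      using f_mult[OF P_in_D P_in_D, OF KW KW, OF that(1,2)] by (simp add: f0 fP that)
    hence "star (V (\<sigma> \<mu>)) * (P (\<sigma> \<mu>) * P (\<sigma> \<nu>)) * V (\<sigma> \<nu>) = 0" by simp
    thus ?thesis using that
      by (simp add: mult.assoc P_mult_V \<sigma>) (simp add: star_V_mult_P \<sigma> flip: mult.assoc)
  qed
  have star_u: "star u = (\<Sum>\<mu>\<in>?K. V \<mu> * star (V (\<sigma> \<mu>)))"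
    by (simp add: u_def star_sum star_mult star_star)
  have Ad_u: "f x = Ad u x" if x: "x \<in> D" for x
  proof -
    have "Ad u x = (\<Sum>\<mu>\<in>?K. \<Sum>\<nu>\<in>?K. V (\<sigma> \<mu>) * (star (V \<mu>) * x * V \<nu>) * star (V (\<sigma> \<nu>)))"
      by (simp add: Ad_def star_u, simp add: u_def sum_distrib_left sum_distrib_right mult.assoc,
          rule sum.swap)
    also have "\<dots> = (\<Sum>\<mu>\<in>?K. V (\<sigma> \<mu>) * (star (V \<mu>) * x * V \<mu>) * star (V (\<sigma> \<mu>)))"
    proof (rule sum.cong[OF refl])
      fix \<mu> assume mu: "\<mu> \<in> ?K"
      have "(\<Sum>\<nu>\<in>?K - {\<mu>}. V (\<sigma> \<mu>) * (star (V \<mu>) * x * V \<nu>) * star (V (\<sigma> \<nu>))) = 0"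
        using mu x by (intro sum.neutral ballI) (simp add: orth)
      thus "(\<Sum>\<nu>\<in>?K. V (\<sigma> \<mu>) * (star (V \<mu>) * x * V \<nu>) * star (V (\<sigma> \<nu>)))
          = V (\<sigma> \<mu>) * (star (V \<mu>) * x * V \<mu>) * star (V (\<sigma> \<mu>))"
        using mu by (simp add: sum.remove[of _ \<mu>])
    qed
    also have "\<dots> = (\<Sum>\<mu>\<in>?K. f (P \<mu> * x))"
    proof (rule sum.cong[OF refl])
      fix \<mu> assume mu: "\<mu> \<in> ?K"
      have "P \<mu> * x = P \<mu> * P \<mu> * x" by (simp add: P_idem KW mu)
      also have "\<dots> = V \<mu> * (star (V \<mu>) * x * V \<mu>) * star (V \<mu>)"
        using D_commute_P[OF x KW[OF mu]] by (simp add: P_word_def mult.assoc)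
      finally show "V (\<sigma> \<mu>) * (star (V \<mu>) * x * V \<mu>) * star (V (\<sigma> \<mu>)) = f (P \<mu> * x)"
        using f_conj[OF mu conj_star_V_in_D[OF x KW[OF mu]]] by simp
    qed
    also have "\<dots> = f (\<Sum>\<mu>\<in>?K. P \<mu> * x)"
      by (rule f_sum[symmetric]) (simp add: D_closed x P_in_D KW)
    also have "(\<Sum>\<mu>\<in>?K. P \<mu> * x) = x" by (simp add: sum_P flip: sum_distrib_right)
    finally show ?thesis by simp
  qed
  have "unitary u"
    unfolding unitary_def
  proof
    show "u * star u = 1" using Ad_u[OF one_in_D] by (simp add: f1 Ad_def)
    have "star u * u = (\<Sum>\<mu>\<in>?K. \<Sum>\<nu>\<in>?K. V \<mu> * (star (V (\<sigma> \<mu>)) * V (\<sigma> \<nu>)) * star (V \<nu>))"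
      by (simp add: star_u, simp add: u_def sum_distrib_left sum_distrib_right mult.assoc,
          rule sum.swap)
    also have "\<dots> = (\<Sum>\<mu>\<in>?K. P \<mu>)"
    proof (rule sum.cong[OF refl])
      fix \<mu> assume mu: "\<mu> \<in> ?K"
      have "(\<Sum>\<nu>\<in>?K - {\<mu>}. V \<mu> * (star (V (\<sigma> \<mu>)) * V (\<sigma> \<nu>)) * star (V \<nu>)) = 0"
        using mu by (intro sum.neutral ballI) (simp add: orth')
      thus "(\<Sum>\<nu>\<in>?K. V \<mu> * (star (V (\<sigma> \<mu>)) * V (\<sigma> \<nu>)) * star (V \<nu>)) = P \<mu>"
        using mu by (simp add: sum.remove[of _ \<mu>] V_isometry \<sigma> P_word_def)
    qed
    finally show "star u * u = 1" by (simp add: sum_P)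
  qed
  moreover have "u \<in> cuntz_algebra n S"
  proof -
    have sub: "cstar_subalgebra (cuntz_algebra n S)"
      unfolding cuntz_algebra_def by (rule cstar_subalgebra_hull)
    note alg = cstar_subalgebraD(3-5)[OF sub]
    have S: "S i \<in> cuntz_algebra n S" if "i \<in> {1..n}" for i
      unfolding cuntz_algebra_def using that by (intro hull_inc) auto
    \<comment> \<open>The unit is obtained as \<open>star (S 1) * S 1\<close>; it starts the
      induction on words.\<close>
    have "1 \<in> cuntz_algebra n S"
      using alg(2)[OF alg(3)[OF S[of 1]] S[of 1]] isometry[of 1] n by simp
    hence "V \<mu> \<in> cuntz_algebra n S" if "\<mu> \<in> W" for \<mu>
      using that by (induction \<mu>) (auto simp: S_word_Cons S alg)
    thus ?thesis unfolding u_def using \<sigma> KW by (intro cstar_subalgebra_sum[OF sub] alg) auto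
  qed
  moreover have "\<exists>ps\<in>lists (W \<times> W). u = (\<Sum>(\<alpha>, \<beta>)\<leftarrow>ps. V \<alpha> * star (V \<beta>))"
  proof -
    obtain xs where xs: "set xs = ?K" "distinct xs"
      using finite_distinct_list[OF finite_words_of_length] by blast
    have "u = (\<Sum>(\<alpha>, \<beta>)\<leftarrow>map (\<lambda>\<mu>. (\<sigma> \<mu>, \<mu>)) xs. V \<alpha> * star (V \<beta>))"
      by (simp add: u_def xs(1)[symmetric] sum.distinct_set_conv_list[OF xs(2)] comp_def)
    moreover have "map (\<lambda>\<mu>. (\<sigma> \<mu>, \<mu>)) xs \<in> lists (W \<times> W)" using xs(1) \<sigma> KW by auto
    ultimately show ?thesis by blast
  qed
  ultimately have "u \<in> cuntz_unitary_group n S" by (simp add: cuntz_unitary_group_def)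
  thus ?thesis using Ad_u by blast
qed

text \<open>Comparing \<open>f (P \<mu>)\<close> with \<open>f (P (\<mu> @ [t]))\<close> pins down the length of the word \<open>\<sigma>\<close>.\<close>

lemma standard_image_word:
  assumes n: "n \<ge> 2" and \<sigma>: "\<sigma> \<in> W" and \<rho>: "\<rho> \<in> W" "\<rho> \<noteq> []"
    and one: "P \<sigma> = P \<sigma> * (\<phi> ^^ m) (P \<rho>)"
    and nonzero: "\<And>t. t \<in> {1..n} \<Longrightarrow> P \<sigma> * (\<phi> ^^ m) (P (\<rho> @ [t])) \<noteq> 0"
  shows "\<exists>\<tau>\<in>W. length \<tau> = m \<and> \<sigma> = \<tau> @ \<rho>"
proof -
  have other: "\<exists>t\<in>{1..n}. t \<noteq> s" for s :: nat using n by (intro bexI[of _ "if s = 1 then 2 else 1"]) auto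
  have shift: "P (\<tau> @ \<kappa>) * (\<phi> ^^ length \<tau>) (P \<nu>) = P (\<tau> @ \<kappa>) * P (\<tau> @ \<nu>)"
    if "\<tau> \<in> W" "\<kappa> \<in> W" for \<tau> \<kappa> \<nu>
    using P_mult_shift_power[OF that, of "P \<nu>"] by (simp add: P_word_append)
  have "length \<sigma> \<ge> m + length \<rho>"
  proof (rule ccontr)
    assume short: "\<not> ?thesis"
    \<comment> \<open>\<sigma> is padded with copies of t to length m + |\<rho>|. The hypothesis
      \<open>one\<close> forces the padded word to end in \<rho>, although its last letter t differs
      from that of \<rho>.\<close>
    obtain t where t: "t \<in> {1..n}" "t \<noteq> last \<rho>" using other by blast
    define \<kappa> where "\<kappa> = replicate (m + length \<rho> - length \<sigma>) t"
    have \<kappa>: "\<kappa> \<in> W" "\<kappa> \<noteq> []" "last \<kappa> = t"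
      using t(1) short by (auto simp: \<kappa>_def cuntz_words_def)
    define \<tau> \<tau>' where "\<tau> = take m (\<sigma> @ \<kappa>)" and "\<tau>' = drop m (\<sigma> @ \<kappa>)"
    have len: "length (\<sigma> @ \<kappa>) = m + length \<rho>" using short by (simp add: \<kappa>_def)
    have split: "\<sigma> @ \<kappa> = \<tau> @ \<tau>'" by (simp only: \<tau>_def \<tau>'_def append_take_drop_id)
    have \<tau>: "\<tau> \<in> W" "\<tau>' \<in> W" "length \<tau> = m" "length \<tau>' = length \<rho>"
      unfolding \<tau>_def \<tau>'_def using \<sigma> \<kappa>(1) len by (auto simp del: take_append drop_append)
    have "P (\<sigma> @ \<kappa>) = P (\<sigma> @ \<kappa>) * P \<sigma>" using \<sigma> \<kappa> by (simp add: P_append_mult)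
    also have "\<dots> = P (\<sigma> @ \<kappa>) * (P \<sigma> * (\<phi> ^^ m) (P \<rho>))" by (rule arg_cong[OF one])
    also have "\<dots> = P (\<sigma> @ \<kappa>) * (\<phi> ^^ m) (P \<rho>)"
      using \<sigma> \<kappa> by (simp add: P_append_mult flip: mult.assoc)
    also have "\<dots> = P (\<tau> @ \<tau>') * P (\<tau> @ \<rho>)"
      using shift[OF \<tau>(1,2), of \<rho>] by (simp only: split \<tau>(3))
    finally have "P (\<tau> @ \<tau>') * P (\<tau> @ \<rho>) \<noteq> 0" using P_neq_0[of "\<sigma> @ \<kappa>"] \<sigma> \<kappa> by simp
    hence "\<not> (\<tau> @ \<tau>' \<parallel> \<tau> @ \<rho>)" using P_parallel \<tau> \<rho> by auto
    hence "\<not> (\<tau>' \<parallel> \<rho>)" by (auto simp: parallel_def)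
    hence "\<tau>' = \<rho>" using \<tau>(4) by (auto simp: parallel_def prefix_def)
    moreover have "last \<tau>' = t" using split \<kappa> \<rho> \<tau>(4) by (metis last_appendR length_0_conv)
    ultimately show False using t by simp
  qed
  define \<tau> \<tau>' where "\<tau> = take m \<sigma>" and "\<tau>' = drop m \<sigma>"
  have \<tau>: "\<tau> \<in> W" "\<tau>' \<in> W" "length \<tau> = m" "length \<tau>' \<ge> length \<rho>" and split: "\<sigma> = \<tau> @ \<tau>'"
    unfolding \<tau>_def \<tau>'_def using \<sigma> \<open>length \<sigma> \<ge> _\<close> by auto
  have shift': "P \<sigma> * (\<phi> ^^ m) (P \<nu>) = P (\<tau> @ \<tau>') * P (\<tau> @ \<nu>)" for \<nu>
    using shift[OF \<tau>(1,2)] by (simp add: \<tau>(3) split)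
  have "P (\<tau> @ \<tau>') * P (\<tau> @ \<rho>) \<noteq> 0"
    using trans[OF one shift'[of \<rho>]] P_neq_0[OF \<sigma>] by metis
  hence "\<not> (\<tau> @ \<tau>' \<parallel> \<tau> @ \<rho>)" using P_parallel \<tau> \<rho> by auto
  hence "\<not> (\<tau>' \<parallel> \<rho>)" by (auto simp: parallel_def)
  then obtain \<kappa> where \<kappa>: "\<tau>' = \<rho> @ \<kappa>" using \<tau>(4) by (auto simp: parallel_def prefix_def)
  have "\<kappa> = []"
  proof (cases \<kappa>)
    case (Cons s \<kappa>')
    \<comment> \<open>If a letter s followed \<rho> in \<sigma>, then for t different from s the
      projection \<open>P \<sigma>\<close> would annihilate the shifted
      \<open>P (\<rho> @ [t])\<close>, contrary to \<open>nonzero\<close>.\<close>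
    obtain t where t: "t \<in> {1..n}" "t \<noteq> s" using other by blast
    have "\<tau> @ \<tau>' \<parallel> \<tau> @ \<rho> @ [t]" using t by (simp add: \<kappa> Cons parallel_def)
    hence "P \<sigma> * (\<phi> ^^ m) (P (\<rho> @ [t])) = 0"
      unfolding shift' using t \<tau> \<rho> by (intro P_parallel) auto
    with nonzero[OF t(1)] show ?thesis by simp
  qed
  with \<kappa> split \<tau> show ?thesis by auto
qed

text \<open>Treating all words of one length K makes the \<open>P \<mu>\<close> a partition of 1,
  the setting of \<open>inner_of_word_map\<close>.\<close>

lemma conditions_imp_inner:
  fixes r :: nat
  assumes n: "n \<ge> 2" and f: "cstar_automorphism_on D f"
    and standard: "eventually_preserves_standard_projections n S f"
    and proj: "\<And>i. i \<in> {1..r} \<Longrightarrow> R i \<in> D" "\<And>i. i \<in> {1..r} \<Longrightarrow> projection (R i)"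
    and sum: "(\<Sum>i=1..r. R i) = 1"
    and rel: "\<And>i x. i \<in> {1..r} \<Longrightarrow> x \<in> D \<Longrightarrow> f (R i * (\<phi> ^^ k i) x) = Q i * (\<phi> ^^ m i) x"
  shows "\<exists>u\<in>cuntz_unitary_group n S. \<forall>x\<in>D. f x = Ad u x"
proof -
  have f_mult: "f (x * y) = f x * f y" and f_add: "f (x + y) = f x + f y" if "x \<in> D" "y \<in> D" for x y
    using f that by (auto simp: cstar_automorphism_on_def)
  have D0: "0 \<in> D" by (rule cstar_subalgebraD(2)[OF D_subalgebra])
  have f0: "f 0 = 0" using f_add[OF D0 D0] by simp
  have inj: "inj_on f D" using f by (simp add: cstar_automorphism_on_def bij_betw_def)
  from standard obtain M where M: "\<And>\<alpha>. \<alpha> \<in> W \<Longrightarrow> length \<alpha> \<ge> M \<Longrightarrow> f (P \<alpha>) \<in> P ` W"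
    by (auto simp: eventually_preserves_standard_projections_def standard_projections_def)
  have "\<forall>i\<in>{1..r}. \<exists>K. \<forall>\<mu>\<in>W. length \<mu> \<ge> K \<longrightarrow> P \<mu> * R i = 0 \<or> P \<mu> * R i = P \<mu>"
    using projection_eventually_scalar proj by blast
  then obtain KR where KR: "\<And>i \<mu>. i \<in> {1..r} \<Longrightarrow> \<mu> \<in> W \<Longrightarrow> length \<mu> \<ge> KR i \<Longrightarrow>
      P \<mu> * R i = 0 \<or> P \<mu> * R i = P \<mu>"
    by metis
  \<comment> \<open>The summands ensure in turn that \<open>f (P \<mu>)\<close> is standard, that
    every \<open>R i\<close> is 0 or 1 below \<open>P \<mu>\<close>, and that \<mu> has more than
    \<open>k i\<close> letters, so that the tail \<rho> is nonempty.\<close>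
  define K where "K = M + (\<Sum>i=1..r. KR i) + (\<Sum>i=1..r. k i) + 1"
  have K: "KR i \<le> K" "k i < K" if "i \<in> {1..r}" for i
    using member_le_sum[of i "{1..r}" KR] member_le_sum[of i "{1..r}" k] that
    by (auto simp: K_def)
  have "\<exists>\<sigma>\<in>W. \<forall>y\<in>D. f (V \<mu> * y * star (V \<mu>)) = V \<sigma> * y * star (V \<sigma>)"
    if mu: "\<mu> \<in> words_of_length n K" for \<mu>
  proof -
    have \<mu>: "\<mu> \<in> W" "length \<mu> = K" using mu by (auto simp: words_of_length_def)
    \<comment> \<open>As the \<open>R i\<close> sum to 1, one of them is nonzero on
      \<open>P \<mu>\<close> and therefore dominates it.\<close>
    have "\<exists>i\<in>{1..r}. P \<mu> * R i \<noteq> 0"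
    proof (rule ccontr)
      assume "\<not> ?thesis"
      hence "P \<mu> * (\<Sum>i=1..r. R i) = 0" by (simp add: sum_distrib_left)
      thus False using P_neq_0[OF \<mu>(1)] unfolding sum by simp
    qed
    then obtain i where i: "i \<in> {1..r}" "P \<mu> * R i \<noteq> 0" by blast
    hence PR: "P \<mu> * R i = P \<mu>" using KR[of i \<mu>] K[of i] \<mu> by auto
    obtain \<sigma> where \<sigma>: "\<sigma> \<in> W" "f (P \<mu>) = P \<sigma>" using M[OF \<mu>(1)] \<mu>(2) by (auto simp: K_def)
    have PQ: "f (P \<mu> * (\<phi> ^^ k i) x) = P \<sigma> * Q i * (\<phi> ^^ m i) x" if x: "x \<in> D" for x
    proof -
      have "P \<mu> * (\<phi> ^^ k i) x = P \<mu> * (R i * (\<phi> ^^ k i) x)" by (simp add: PR flip: mult.assoc)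
      moreover have "f (P \<mu> * (R i * (\<phi> ^^ k i) x)) = f (P \<mu>) * f (R i * (\<phi> ^^ k i) x)"
        by (intro f_mult P_in_D D_closed shift_power_in_D proj \<mu> i x)
      ultimately show ?thesis by (simp only: rel[OF i(1) x] \<sigma>(2) mult.assoc)
    qed
    \<comment> \<open>Evaluation at 1, which the shift fixes, shows that \<open>P \<sigma>\<close>
      absorbs \<open>Q i\<close>.\<close>
    have "P \<sigma> = P \<sigma> * Q i" using PQ[OF one_in_D] by (simp add: \<sigma>)
    hence shifted: "f (P \<mu> * (\<phi> ^^ k i) x) = P \<sigma> * (\<phi> ^^ m i) x" if "x \<in> D" for x
      using PQ[OF that] by simp
    \<comment> \<open>The \<open>k i\<close> shifts account for the first \<open>k i\<close> letters
      of \<mu>. The tail \<rho> is moved into the argument, so that conjugation by all of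
      \<open>V \<mu>\<close> becomes a case of \<open>shifted\<close>.\<close>
    define \<mu>1 \<rho> where "\<mu>1 = take (k i) \<mu>" and "\<rho> = drop (k i) \<mu>"
    have split: "\<mu> = \<mu>1 @ \<rho>" "length \<mu>1 = k i" "\<mu>1 \<in> W" "\<rho> \<in> W" "\<rho> \<noteq> []"
      unfolding \<mu>1_def \<rho>_def using \<mu> K[OF i(1)] by auto
    have conj: "f (V \<mu> * y * star (V \<mu>)) = P \<sigma> * (\<phi> ^^ m i) (V \<rho> * y * star (V \<rho>))" if y: "y \<in> D" for y
    proof -
      have "P \<mu> * (\<phi> ^^ k i) (V \<rho> * y * star (V \<rho>)) = P \<mu> * (V \<mu> * y * star (V \<mu>))"
        using P_mult_shift_power[OF split(3,4)] split(2)
        by (simp add: split(1) S_word_append star_mult mult.assoc)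
      also have "\<dots> = V \<mu> * y * star (V \<mu>)" using \<mu> by (simp add: P_mult_V flip: mult.assoc)
      finally show ?thesis using shifted[OF conj_V_in_D[OF y split(4)]] by simp
    qed
    \<comment> \<open>This is the image of the nonzero projection \<open>P (\<mu> @ [t])\<close>
      under the injective map f.\<close>
    have "P \<sigma> * (\<phi> ^^ m i) (P (\<rho> @ [t])) \<noteq> 0" if "t \<in> {1..n}" for t
    proof -
      have "[t] \<in> W" using that by simp
      hence "P \<sigma> * (\<phi> ^^ m i) (P (\<rho> @ [t])) = f (P (\<mu> @ [t]))"
        using conj[OF P_in_D[of "[t]"]] by (simp add: P_word_append)
      moreover have "P (\<mu> @ [t]) \<in> D" "P (\<mu> @ [t]) \<noteq> 0"
        using that \<mu> by (simp_all add: P_in_D P_neq_0)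
      ultimately show ?thesis using inj f0 D0 by (metis inj_on_contraD)
    qed
    moreover have "P \<sigma> = P \<sigma> * (\<phi> ^^ m i) (P \<rho>)"
      using conj[OF one_in_D] by (simp add: P_word_def[symmetric] \<sigma>)
    ultimately obtain \<tau> where \<tau>: "\<tau> \<in> W" "length \<tau> = m i" "\<sigma> = \<tau> @ \<rho>"
      using standard_image_word[OF n \<sigma>(1) split(4,5)] by blast
    have "f (V \<mu> * y * star (V \<mu>)) = V \<sigma> * y * star (V \<sigma>)" if y: "y \<in> D" for y
    proof -
      note conj[OF y]
      also have "P \<sigma> * (\<phi> ^^ m i) (V \<rho> * y * star (V \<rho>))
          = P \<sigma> * (V \<tau> * (V \<rho> * y * star (V \<rho>)) * star (V \<tau>))"
        using P_mult_shift_power[OF \<tau>(1) split(4)] by (simp only: \<tau>(2,3))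
      also have "\<dots> = P \<sigma> * (V \<sigma> * y * star (V \<sigma>))"
        by (simp add: \<tau>(3) S_word_append star_mult mult.assoc)
      also have "\<dots> = V \<sigma> * y * star (V \<sigma>)" using \<sigma> by (simp add: P_mult_V flip: mult.assoc)
      finally show ?thesis .
    qed
    thus ?thesis using \<sigma>(1) by blast
  qed
  then obtain \<sigma> where \<sigma>: "\<And>\<mu>. \<mu> \<in> words_of_length n K \<Longrightarrow> \<sigma> \<mu> \<in> W \<and>
      (\<forall>y\<in>D. f (V \<mu> * y * star (V \<mu>)) = V (\<sigma> \<mu>) * y * star (V (\<sigma> \<mu>)))"
    by metis
  show ?thesis using n by (intro inner_of_word_map[OF _ f, of K \<sigma>]) (use \<sigma> in auto)
qed

end

theorem proposition6p1:
  fixes n :: nat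
    and S :: "nat \<Rightarrow> 'a::unital_cstar_algebra"
    and f :: "'a \<Rightarrow> 'a"
  assumes "n \<ge> 2"
    and "cuntz_isometries n S"
    and "cstar_automorphism_on (cuntz_diagonal n S) f"
  shows "(\<exists>u \<in> cuntz_unitary_group n S. \<forall>x \<in> cuntz_diagonal n S. f x = Ad u x) \<longleftrightarrow>
    (eventually_preserves_standard_projections n S f \<and>
     (\<exists>(r::nat) (P :: nat \<Rightarrow> 'a) (Q :: nat \<Rightarrow> 'a) (k :: nat \<Rightarrow> nat) (m :: nat \<Rightarrow> nat).
        (\<forall>i\<in>{1..r}. P i \<in> cuntz_diagonal n S \<and> projection (P i) \<and>
                    Q i \<in> cuntz_diagonal n S \<and> projection (Q i)) \<and>
        (\<Sum>i=1..r. P i) = 1 \<and> (\<Sum>i=1..r. Q i) = 1 \<and>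
        (\<forall>i\<in>{1..r}. \<forall>x \<in> cuntz_diagonal n S.
           (f \<circ> left_mult (P i) \<circ> (canonical_shift n S ^^ k i)) x =
           (left_mult (Q i) \<circ> (canonical_shift n S ^^ m i)) x)))"
proof -
  interpret cuntz_family n S by standard fact
  show ?thesis
    unfolding comp_def left_mult_def
  proof (rule iffI)
    assume "\<exists>u\<in>cuntz_unitary_group n S. \<forall>x\<in>D. f x = Ad u x"
    then obtain u where "u \<in> cuntz_unitary_group n S" "\<And>x. x \<in> D \<Longrightarrow> f x = Ad u x" by blast
    from inner_imp_conditions[OF assms(1) this]
    show "eventually_preserves_standard_projections n S f \<and>
     (\<exists>(r::nat) P Q (k :: nat \<Rightarrow> nat) (m :: nat \<Rightarrow> nat).
        (\<forall>i\<in>{1..r}. P i \<in> D \<and> projection (P i) \<and> Q i \<in> D \<and> projection (Q i)) \<and>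
        (\<Sum>i=1..r. P i) = 1 \<and> (\<Sum>i=1..r. Q i) = 1 \<and>
        (\<forall>i\<in>{1..r}. \<forall>x\<in>D. f (P i * (\<phi> ^^ k i) x) = Q i * (\<phi> ^^ m i) x))" ..
  next
    assume "eventually_preserves_standard_projections n S f \<and>
     (\<exists>(r::nat) P Q (k :: nat \<Rightarrow> nat) (m :: nat \<Rightarrow> nat).
        (\<forall>i\<in>{1..r}. P i \<in> D \<and> projection (P i) \<and> Q i \<in> D \<and> projection (Q i)) \<and>
        (\<Sum>i=1..r. P i) = 1 \<and> (\<Sum>i=1..r. Q i) = 1 \<and>
        (\<forall>i\<in>{1..r}. \<forall>x\<in>D. f (P i * (\<phi> ^^ k i) x) = Q i * (\<phi> ^^ m i) x))"
    then obtain r :: nat and R Q k m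
      where "eventually_preserves_standard_projections n S f"
        and "\<forall>i\<in>{1..r}. R i \<in> D \<and> projection (R i) \<and> Q i \<in> D \<and> projection (Q i)"
        and "(\<Sum>i=1..r. R i) = 1"
        and "\<forall>i\<in>{1..r}. \<forall>x\<in>D. f (R i * (\<phi> ^^ k i) x) = Q i * (\<phi> ^^ m i) x"
      by (elim conjE exE) blast
    thus "\<exists>u\<in>cuntz_unitary_group n S. \<forall>x\<in>D. f x = Ad u x"
      by (intro conditions_imp_inner[OF assms(1,3), where r = r and R = R and Q = Q and k = k and m = m]) auto
  qed
qed

end
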